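(* Let $d\ge 1$ and let $c(x,y)=\ell(x-y)$, where $\ell:\mathbb{R}^d\to[0,\infty]$ satisfies $\ell(z)=\ell(-z)$ for all $z$, and either (i) $\ell\in L^1(\mathbb{R}^d)\cap C_b(\mathbb{R}^d)$ and $\hat\ell\ge 0$ on $\mathbb{R}^d$, or (ii) $d=3$ and $\ell(z)=1/|z|$ (Coulomb cost). Let $\mu\in\mathcal{P}(\mathbb{R}^d)$ satisfy $\int_{\mathbb{R}^{2d}} c(x,y)\,\mu(dx)\mu(dy)<\infty$. (a) The independent product measure $\gamma_0=\mu^{\otimes\infty}=\mu\otimes\mu\otimes\cdots$ is a minimizer of the infinite-body optimal transport problem (minimize $C_\infty[\gamma]$ over $\gamma\in\mathcal{P}^\infty_{sym}(\mathbb{R}^d)$ with $\gamma\mapsto\mu$), and $$F^{OT}_\infty[\mu]=\int_{\mathbb{R}^{2d}} c(x,y)\,\mu(dx)\mu(dy).$$ (b) If in addition $\hat\ell(z)>0$ for all $z\in\mathbb{R}^d$ (which holds automatically in case (ii), where $\hat\ell(k)=4\pi/|k|^2$), then $\mu^{\otimes\infty}$ is the unique minimizer of this infinite-body problem.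
   Context: $\mathcal{P}(\mathbb{R}^k)$ denotes Borel probability measures on $\mathbb{R}^k$. $C_b(\mathbb{R}^d)$ is the space of bounded continuous functions. Fourier transform convention: $\hat f(k)=\int_{\mathbb{R}^d}e^{-ik\cdot x}f(x)\,dx$ for $f\in L^1$ (and $\hat Q(k)=\int e^{-ik\cdot x}dQ(x)$ for a probability measure $Q$). $(\mathbb{R}^d)^\infty$ is the countable product of copies of $\mathbb{R}^d$ with the product Borel $\sigma$-algebra. $\mathcal{P}^\infty_{sym}(\mathbb{R}^d)$ is the set of Borel probability measures $\gamma$ on $(\mathbb{R}^d)^\infty$ that are symmetric (exchangeable): for every finite set of indices $i_1<\dots<i_N$, the marginal of $\gamma$ on coordinates $(x_{i_1},\dots,x_{i_N})$ is invariant under permutations of these coordinates. $\gamma\mapsto\mu$ means the one-body marginal of $\gamma$ is $\mu$, i.e. $\gamma(A\times\mathbb{R}^d\times\mathbb{R}^d\times\cdots)=\mu(A)$ for all Borel $A$. For a Borel symmetric cost $c:\mathbb{R}^d\times\mathbb{R}^d\to[0,\infty]$ and $\gamma\in\mathcal{P}^\infty_{sym}(\mathbb{R}^d)$, $C_N[\gamma]=\int\sum_{1\le i<j\le N}c(x_i,x_j)\,d\gamma$ and $C_\infty[\gamma]:=\lim_{N\to\infty}\binom{N}{2}^{-1}C_N[\gamma]$, which equals $\int c(x_1,x_2)\,d\gamma$. $F^{OT}_\infty[\mu]:=\inf\{C_\infty[\gamma]:\gamma\in\mathcal{P}^\infty_{sym}(\mathbb{R}^d),\ \gamma\mapsto\mu\}$.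 *)

theory Defs
  imports "HOL-Probability.Probability"
begin

definition fourier :: "(real^'d \<Rightarrow> real) \<Rightarrow> real^'d \<Rightarrow> complex" where
  "fourier f k = (LINT x|lborel. cis (-(k \<bullet> x)) * complex_of_real (f x))"

abbreviation seq_space :: "(nat \<Rightarrow> real^'d) measure" where
  "seq_space \<equiv> PiM UNIV (\<lambda>_. borel)"

definition symmetric_meas :: "(nat \<Rightarrow> real^'d) measure \<Rightarrow> bool" where
  "symmetric_meas \<gamma> \<longleftrightarrow>
     (\<forall>I \<sigma>. finite I \<and> \<sigma> permutes I \<longrightarrow>
        distr \<gamma> (PiM I (\<lambda>_. borel)) (\<lambda>x. restrict (x \<circ> \<sigma>) I)
          = distr \<gamma> (PiM I (\<lambda>_. borel)) (\<lambda>x. restrict x I))"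

definition admissible :: "(real^'d) measure \<Rightarrow> (nat \<Rightarrow> real^'d) measure \<Rightarrow> bool" where
  "admissible \<mu> \<gamma> \<longleftrightarrow> prob_space \<gamma> \<and> sets \<gamma> = sets seq_space \<and> symmetric_meas \<gamma>
     \<and> distr \<gamma> borel (\<lambda>x. x 0) = \<mu>"

definition C_inf :: "(real^'d \<Rightarrow> real^'d \<Rightarrow> ennreal) \<Rightarrow> (nat \<Rightarrow> real^'d) measure \<Rightarrow> ennreal" where
  "C_inf c \<gamma> = (\<integral>\<^sup>+ x. c (x 0) (x 1) \<partial>\<gamma>)"

definition F_OT_inf :: "(real^'d \<Rightarrow> real^'d \<Rightarrow> ennreal) \<Rightarrow> (real^'d) measure \<Rightarrow> ennreal" where
  "F_OT_inf c \<mu> = (INF \<gamma> \<in> {\<gamma>. admissible \<mu> \<gamma>}. C_inf c \<gamma>)"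

definition case_i :: "(real^'d \<Rightarrow> ennreal) \<Rightarrow> bool" where
  "case_i l \<longleftrightarrow> (\<exists>f. (\<forall>z. f z \<ge> 0) \<and> l = (\<lambda>z. ennreal (f z)) \<and> integrable lborel f
      \<and> continuous_on UNIV f \<and> bounded (range f)
      \<and> (\<forall>k. Im (fourier f k) = 0 \<and> Re (fourier f k) \<ge> 0))"

definition case_i_strict :: "(real^'d \<Rightarrow> ennreal) \<Rightarrow> bool" where
  "case_i_strict l \<longleftrightarrow> (\<exists>f. (\<forall>z. f z \<ge> 0) \<and> l = (\<lambda>z. ennreal (f z)) \<and> integrable lborel f
      \<and> continuous_on UNIV f \<and> bounded (range f)
      \<and> (\<forall>k. Im (fourier f k) = 0 \<and> Re (fourier f k) > 0))"

definition case_ii :: "(real^'d \<Rightarrow> ennreal) \<Rightarrow> bool" where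
  "case_ii l \<longleftrightarrow> CARD('d) = 3 \<and> l = (\<lambda>z. if z = 0 then \<infinity> else ennreal (1 / norm z))"

end

theory Submission
  imports Defs
begin

text \<open>
  Let \<open>x\<^sub>0, x\<^sub>1, \<dots>\<close> be exchangeable with law \<open>\<mu>\<close>. Since \<open>E (Y\<^sub>1 + \<dots> + Y\<^sub>N)\<^sup>2 \<ge> 0\<close> for
  \<open>Y\<^sub>i = \<phi>(x\<^sub>i) - E \<phi>(x\<^sub>i)\<close>, letting \<open>N\<close> tend to infinity shows that \<open>\<phi>(x\<^sub>0)\<close> and \<open>\<phi>(x\<^sub>1)\<close> are
  nonnegatively correlated. With \<open>\<phi> = cos (k \<bullet> x)\<close> and \<open>\<phi> = sin (k \<bullet> x)\<close> this says that the
  characteristic function of \<open>x\<^sub>0 - x\<^sub>1\<close> dominates that of the difference of two independent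
  \<open>\<mu>\<close>-distributed points. A cost of positive type is a nonnegative superposition of functions
  \<open>cos (k \<bullet> z)\<close>, so its expectation is minimal for independent points. In case (i) the superposition
  is obtained by mollifying \<open>\<ell>\<close> with a Gaussian, which avoids Fourier inversion; the Coulomb cost is
  the superposition \<open>1/|z| = (2\<pi>)\<^sup>-\<^sup>1\<^sup>/\<^sup>2 \<integral> exp (- t\<^sup>2 |z|\<^sup>2 / 2) dt\<close> of Gaussians.

  If the minimum is attained and all weights are positive, then for almost all \<open>k\<close> the correlations
  above vanish. The averages of \<open>\<phi>(x\<^sub>i)\<close> then converge in \<open>L\<^sup>2\<close> to a constant, so \<open>\<phi>(x\<^sub>n)\<close> is
  uncorrelated with every bounded function of the other coordinates. By uniqueness of
  characteristic functions \<open>x\<^sub>0\<close> and \<open>x\<^sub>1\<close> are independent; applying the same argument to indicator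
  functions \<open>\<phi>\<close> gives independence of all coordinates by induction.
\<close>

section \<open>Gaussian measures on Euclidean space\<close>

definition gauss :: "real \<Rightarrow> 'a::euclidean_space \<Rightarrow> real" where
  "gauss s x = exp (- (norm x)\<^sup>2 / (2 * s\<^sup>2)) / sqrt (2 * pi * s\<^sup>2) ^ DIM('a)"

definition normal_measure :: "real \<Rightarrow> 'a::euclidean_space measure" where
  "normal_measure s = density lborel (\<lambda>x. ennreal (gauss s x))"

lemma gauss_eq_prod_normal_density:
  fixes x :: "'a::euclidean_space"
  shows "gauss s x = (\<Prod>b\<in>Basis. normal_density 0 s (x \<bullet> b))"
proof -
  have "(norm x)\<^sup>2 = (\<Sum>b\<in>Basis. (x \<bullet> b)\<^sup>2)"
    by (simp add: norm_eq_sqrt_inner euclidean_inner[of x x] sum_nonneg power2_eq_square)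
  then have "exp (- (norm x)\<^sup>2 / (2 * s\<^sup>2)) = (\<Prod>b\<in>Basis. exp (- (x \<bullet> b)\<^sup>2 / (2 * s\<^sup>2)))"
    by (simp add: exp_sum[symmetric] sum_negf[symmetric] sum_divide_distrib)
  then show ?thesis
    by (simp add: gauss_def normal_density_def prod.distrib prod_dividef)
qed

lemma gauss_pos: "s \<noteq> 0 \<Longrightarrow> 0 < gauss s x"
  by (simp add: gauss_def)

lemma gauss_nonneg [simp]: "0 \<le> gauss s x"
  by (simp add: gauss_def)

lemma gauss_minus_commute: "gauss s (x - y) = gauss s (y - x)"
  by (simp add: gauss_def norm_minus_commute)

lemma borel_measurable_gauss [measurable]: "gauss s \<in> borel_measurable borel"
  unfolding gauss_def by measurable

lemma sets_normal_measure [simp, measurable_cong]: "sets (normal_measure s) = sets borel"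
  by (simp add: normal_measure_def)

lemma space_normal_measure [simp]: "space (normal_measure s) = UNIV"
  by (simp add: normal_measure_def)

lemma nn_integral_gauss:
  assumes "0 < s"
  shows "(\<integral>\<^sup>+ x. ennreal (gauss s (x :: 'a::euclidean_space)) \<partial>lborel) = 1"
proof -
  have "(\<integral>\<^sup>+ x. ennreal (gauss s (x :: 'a)) \<partial>lborel)
      = (\<integral>\<^sup>+ x. (\<Prod>b\<in>(Basis::'a set). ennreal (normal_density 0 s (x \<bullet> b))) \<partial>lborel)"
    by (simp add: gauss_eq_prod_normal_density prod_ennreal)
  also have "\<dots> = (\<Prod>b\<in>(Basis::'a set). (\<integral>\<^sup>+ x. ennreal (normal_density 0 s x) \<partial>lborel))"
    by (rule nn_integral_lborel_prod) auto
  also have "\<dots> = 1"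
    using assms by (simp add: nn_integral_eq_integral)
  finally show ?thesis .
qed

lemma prob_space_normal_measure: "0 < s \<Longrightarrow> prob_space (normal_measure s)"
  by (rule prob_spaceI) (simp add: normal_measure_def emeasure_density nn_integral_gauss)

lemma AE_normal_measure_iff:
  assumes "s \<noteq> 0"
  shows "(AE x in normal_measure s. P x) \<longleftrightarrow> (AE x in lborel. P x)"
  unfolding normal_measure_def using gauss_pos[OF assms] by (subst AE_density) auto

text \<open>Change of variables. Moving the width from the measure into the argument lets limits in
  \<open>s\<close> be taken under the fixed probability measure
  \<open>normal_measure 1\<close>.\<close>

lemma normal_measure_scale:
  assumes "0 < s"
  shows "normal_measure s = distr (normal_measure 1) borel (\<lambda>x. s *\<^sub>R (x :: 'a::euclidean_space))"
proof (rule measure_eqI)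
  fix A :: "'a set" assume "A \<in> sets (normal_measure s)"
  then have [measurable]: "A \<in> sets borel" by simp
  \<comment> \<open>The Jacobian \<open>s ^ DIM('a)\<close> cancels the powers of \<open>s\<close>
    in the normalising constant of the density.\<close>
  have g: "ennreal (s ^ DIM('a)) * ennreal (gauss s (s *\<^sub>R x)) = ennreal (gauss 1 x)" for x :: 'a
    using assms
    by (simp add: gauss_def ennreal_mult[symmetric] power_mult_distrib real_sqrt_mult)
  have "emeasure (normal_measure s) A = (\<integral>\<^sup>+ x. ennreal (gauss s x) * indicator A x \<partial>lborel)"
    by (simp add: normal_measure_def emeasure_density)
  also have "\<dots> = (\<integral>\<^sup>+ x. ennreal (s ^ DIM('a)) * (ennreal (gauss s (s *\<^sub>R x)) * indicator A (s *\<^sub>R x)) \<partial>lborel)"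
    using assms by (subst lborel_affine[of s 0]) (simp_all add: nn_integral_density nn_integral_distr)
  also have "\<dots> = (\<integral>\<^sup>+ x. ennreal (gauss 1 x) * indicator A (s *\<^sub>R x) \<partial>lborel)"
    by (simp add: g mult.assoc[symmetric])
  also have "\<dots> = (\<integral>\<^sup>+ x. ennreal (gauss 1 x) * indicator ((\<lambda>x. s *\<^sub>R x) -` A) x \<partial>lborel)"
    by (simp add: indicator_def)
  also have "\<dots> = emeasure (distr (normal_measure 1) borel (\<lambda>x. s *\<^sub>R x)) A"
    by (simp add: emeasure_distr)
       (simp add: normal_measure_def emeasure_density measurable_sets_borel[where M=borel])
  finally show "emeasure (normal_measure s) A = \<dots>" .
qed simp

section \<open>Characteristic functions of Gaussian measures\<close>

lemma borel_measurable_cis [measurable (raw)]: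
  "f \<in> borel_measurable M \<Longrightarrow> (\<lambda>x. cis (f x)) \<in> borel_measurable M"
  by (rule borel_measurable_continuous_on) (auto simp: cis_conv_exp intro!: continuous_intros)

lemma integral_normal_density_cis:
  "(\<integral>x. complex_of_real (std_normal_density x) * cis (t * x) \<partial>lborel) = complex_of_real (exp (- t\<^sup>2 / 2))"
proof -
  have "(\<integral>x. complex_of_real (std_normal_density x) * cis (t * x) \<partial>lborel)
     = (\<integral>x. std_normal_density x *\<^sub>R cis (t * x) \<partial>lborel)"
    by (simp add: scaleR_conv_of_real)
  also have "\<dots> = char std_normal_distribution t"
    unfolding char_def
    by (subst integral_density) (auto simp: cis_conv_exp)
  finally show ?thesis by (simp add: char_std_normal_distribution)
qed

text \<open>The computation is made for \<open>cis\<close>, which factorises over the coordinates as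
  \<open>cos\<close> does not. Each factor is the characteristic function of the standard normal
  distribution, and the real part is taken at the end.\<close>

lemma integral_normal_measure_cos_1:
  "(\<integral>k. cos (k \<bullet> z) \<partial>normal_measure 1) = exp (- (norm z)\<^sup>2 / 2)"
proof -
  interpret prob_space "normal_measure 1 :: 'a measure" by (rule prob_space_normal_measure) simp
  interpret product_sigma_finite "\<lambda>_::'a. lborel :: real measure" ..
  have "(\<integral>k. cis (k \<bullet> z) \<partial>normal_measure 1)
      = (\<integral>k. gauss 1 k *\<^sub>R cis (k \<bullet> z) \<partial>lborel)"
    unfolding normal_measure_def by (rule integral_density) auto
  also have "\<dots> = (\<integral>f. gauss 1 (\<Sum>b\<in>Basis. f b *\<^sub>R b) *\<^sub>R cis ((\<Sum>b\<in>Basis. f b *\<^sub>R b) \<bullet> z) \<partial>(\<Pi>\<^sub>M b\<in>(Basis::'a set). lborel))"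
    by (subst lborel_eq) (rule integral_distr; measurable)
  also have "\<dots> = (\<integral>f. (\<Prod>b\<in>Basis. complex_of_real (std_normal_density (f b)) * cis ((z \<bullet> b) * f b)) \<partial>(\<Pi>\<^sub>M b\<in>(Basis::'a set). lborel))"
  proof (rule Bochner_Integration.integral_cong[OF refl])
    fix f :: "'a \<Rightarrow> real"
    have "cis ((\<Sum>b\<in>Basis. f b *\<^sub>R b) \<bullet> z) = (\<Prod>b\<in>Basis. cis ((z \<bullet> b) * f b))"
    proof -
      have "(\<Sum>b\<in>Basis. f b *\<^sub>R b) \<bullet> z = (\<Sum>b\<in>Basis. (z \<bullet> b) * f b)"
        by (simp only: inner_sum_left inner_scaleR_left) (simp only: inner_commute mult.commute)
      then show ?thesis
        by (simp add: cis_conv_exp sum_distrib_left exp_sum[symmetric])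
    qed
    then show "gauss 1 (\<Sum>b\<in>Basis. f b *\<^sub>R b) *\<^sub>R cis ((\<Sum>b\<in>Basis. f b *\<^sub>R b) \<bullet> z)
       = (\<Prod>b\<in>Basis. complex_of_real (std_normal_density (f b)) * cis ((z \<bullet> b) * f b))"
      by (simp add: gauss_eq_prod_normal_density scaleR_conv_of_real prod.distrib)
  qed
  also have "\<dots> = (\<Prod>b\<in>Basis. \<integral>x. complex_of_real (std_normal_density x) * cis ((z \<bullet> b) * x) \<partial>lborel)"
  proof (rule product_integral_prod)
    fix b :: 'a
    show "integrable lborel (\<lambda>x. complex_of_real (std_normal_density x) * cis ((z \<bullet> b) * x))"
      by (rule Bochner_Integration.integrable_bound[OF integrable_normal_density[of 1 0]])
         (auto simp: norm_mult)
  qed simp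
  also have "\<dots> = complex_of_real (exp (- (norm z)\<^sup>2 / 2))"
  proof -
    have "(norm z)\<^sup>2 = (\<Sum>b\<in>Basis. (z \<bullet> b)\<^sup>2)"
      by (simp add: norm_eq_sqrt_inner euclidean_inner[of z z] sum_nonneg power2_eq_square)
    then show ?thesis
      by (simp add: integral_normal_density_cis of_real_prod[symmetric] exp_sum[symmetric] sum_negf
          sum_divide_distrib[symmetric] del: of_real_exp of_real_prod)
  qed
  finally have "Re (\<integral>k. cis (k \<bullet> z) \<partial>normal_measure 1) = exp (- (norm z)\<^sup>2 / 2)"
    by simp
  moreover have "integrable (normal_measure 1) (\<lambda>k::'a. cis (k \<bullet> z))"
    by (rule integrable_const_bound[of _ 1]) auto
  ultimately show ?thesis
    using integral_Re[of "normal_measure 1" "\<lambda>k::'a. cis (k \<bullet> z)"] by simp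
qed

lemma integral_normal_measure_cos:
  assumes "0 < s"
  shows "(\<integral>k. cos (k \<bullet> z) \<partial>normal_measure s) = exp (- (s * norm z)\<^sup>2 / 2)"
proof -
  have "(\<integral>k. cos (k \<bullet> z) \<partial>normal_measure s) = (\<integral>k. cos (k \<bullet> (s *\<^sub>R z)) \<partial>normal_measure 1)"
    by (subst normal_measure_scale[OF assms]) (subst integral_distr; simp)
  then show ?thesis
    using assms by (simp only: integral_normal_measure_cos_1) (simp add: abs_mult)
qed

text \<open>Explicit Fourier inversion for Gaussians: width \<open>s\<close> in space corresponds to
  width \<open>1 / s\<close> in frequency.\<close>

lemma gauss_eq_integral_cos:
  fixes v :: "'a::euclidean_space"
  assumes "0 < s"
  shows "gauss s v = (\<integral>k. cos (k \<bullet> v) \<partial>normal_measure (1 / s)) / sqrt (2 * pi * s\<^sup>2) ^ DIM('a)"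
  using assms by (simp add: gauss_def integral_normal_measure_cos power_divide)

section \<open>Mollification by Gaussians\<close>

lemma integral_normal_measure_shift:
  fixes f :: "'a::euclidean_space \<Rightarrow> real"
  assumes [measurable]: "f \<in> borel_measurable borel"
  shows "(\<integral>y. f (x + y) \<partial>normal_measure s) = (\<integral>u. gauss s (u - x) * f u \<partial>lborel)"
proof -
  have "(\<integral>y. f (x + y) \<partial>normal_measure s) = (\<integral>y. gauss s y * f (x + y) \<partial>lborel)"
    unfolding normal_measure_def by (subst integral_density) auto
  also have "\<dots> = (\<integral>u. gauss s (u - x) * f u \<partial>distr lborel borel ((+) x))"
    by (subst integral_distr) auto
  finally show ?thesis by (simp add: lborel_distr_plus)
qed

text \<open>After rescaling, \<open>s n\<close> occurs only in the argument of \<open>f\<close>, so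
  continuity gives pointwise convergence and \<open>B\<close> dominates.\<close>

lemma mollification_tendsto:
  fixes f :: "'a::euclidean_space \<Rightarrow> real"
  assumes cont: "continuous_on UNIV f" and bdd: "\<And>x. \<bar>f x\<bar> \<le> B"
    and s: "\<And>n. 0 < s n" "s \<longlonglongrightarrow> 0"
  shows "(\<lambda>n. \<integral>y. f (x + y) \<partial>normal_measure (s n)) \<longlonglongrightarrow> f x"
proof -
  interpret prob_space "normal_measure 1 :: 'a measure" by (rule prob_space_normal_measure) simp
  have [measurable]: "f \<in> borel_measurable borel"
    using cont by (rule borel_measurable_continuous_onI)
  have "(\<lambda>n. \<integral>y. f (x + s n *\<^sub>R y) \<partial>normal_measure 1) \<longlonglongrightarrow> (\<integral>y. f x \<partial>(normal_measure 1 :: 'a measure))"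
  proof (rule integral_dominated_convergence[where w="\<lambda>_. B"])
    show "AE y in normal_measure 1. (\<lambda>n. f (x + s n *\<^sub>R y)) \<longlonglongrightarrow> f x"
    proof (rule AE_I2)
      fix y :: 'a
      have "(\<lambda>n. x + s n *\<^sub>R y) \<longlonglongrightarrow> x + 0 *\<^sub>R y" by (intro tendsto_intros s)
      then show "(\<lambda>n. f (x + s n *\<^sub>R y)) \<longlonglongrightarrow> f x"
        using cont by (intro continuous_on_tendsto_compose[OF cont]) auto
    qed
  qed (use bdd in auto)
  moreover have "(\<integral>y. f (x + y) \<partial>normal_measure (s n)) = (\<integral>y. f (x + s n *\<^sub>R y) \<partial>normal_measure 1)" for n
    by (subst normal_measure_scale[OF s(1)]) (subst integral_distr; simp)
  ultimately show ?thesis using prob_space by simp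
qed

lemma mollification_bounded:
  fixes f :: "'a::euclidean_space \<Rightarrow> real"
  assumes "0 < s" "\<And>x. \<bar>f x\<bar> \<le> B"
  shows "\<bar>\<integral>y. f (x + y) \<partial>normal_measure s\<bar> \<le> B"
proof -
  interpret prob_space "normal_measure s :: 'a measure" by (rule prob_space_normal_measure) fact
  have "\<bar>\<integral>y. f (x + y) \<partial>normal_measure s\<bar> \<le> (\<integral>y. \<bar>f (x + y)\<bar> \<partial>normal_measure s)"
    using integral_norm_bound[of _ "\<lambda>y. f (x + y)"] by simp
  also have "\<dots> \<le> (\<integral>y. B \<partial>(normal_measure s :: 'a measure))"
    using assms(2) order_trans[OF abs_ge_zero assms(2)] by (intro integral_mono') auto
  finally show ?thesis using prob_space by simp
qed

section \<open>Uniqueness of characteristic functions\<close>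

text \<open>Closed sets form an intersection-stable generator of the Borel sets, and the indicator
  of a nonempty closed set is a pointwise limit of continuous functions with values in the unit
  interval.\<close>

lemma finite_measure_eqI_continuous:
  fixes M N :: "'a::euclidean_space measure"
  assumes fin: "finite_measure M" "finite_measure N"
    and sets: "sets M = sets borel" "sets N = sets borel"
    and eq: "\<And>f :: 'a \<Rightarrow> real. continuous_on UNIV f \<Longrightarrow> (\<And>x. 0 \<le> f x) \<Longrightarrow> (\<And>x. f x \<le> 1) \<Longrightarrow>
      integral\<^sup>L M f = integral\<^sup>L N f"
  shows "M = N"
proof -
  note [measurable_cong] = sets
  interpret M: finite_measure M by fact
  interpret N: finite_measure N by fact
  have space: "space M = UNIV" "space N = UNIV"
    using sets[THEN sets_eq_imp_space_eq] by auto
  \<comment> \<open>\<open>infdist x {}\<close> is 0 by convention, which would make each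
    \<open>f n\<close> below constantly 1, so the empty set is treated separately.\<close>
  have ne: "emeasure M A = emeasure N A" if A: "closed A" "A \<noteq> {}" for A
  proof -
    define f where "f n x = max 0 (1 - real n * infdist x A)" for n x
    have cont: "continuous_on UNIV (f n)" for n
      unfolding f_def by (intro continuous_intros)
    have f01: "0 \<le> f n x" "f n x \<le> 1" for n x
      by (auto simp: f_def infdist_nonneg)
    have [measurable]: "f n \<in> borel_measurable borel" for n
      using cont by (rule borel_measurable_continuous_onI)
    have [measurable]: "A \<in> sets borel" using A by simp
    have lim: "(\<lambda>n. f n x) \<longlonglongrightarrow> indicator A x" for x
    proof (cases "x \<in> A")
      case True
      then show ?thesis by (simp add: f_def)
    next
      case False
      then have d: "0 < infdist x A" using A by (intro infdist_pos_not_in_closed)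
      obtain n0 :: nat where n0: "1 / infdist x A < real n0" using reals_Archimedean2 by blast
      have "f n x = 0" if "n0 \<le> n" for n
      proof -
        have "1 / infdist x A < real n" using n0 that by linarith
        then show ?thesis using d by (simp add: f_def field_simps)
      qed
      then have "\<forall>\<^sub>F n in sequentially. f n x = 0"
        by (auto simp: eventually_sequentially)
      then show ?thesis using False by (simp add: tendsto_eventually)
    qed
    have "(\<lambda>n. integral\<^sup>L M (f n)) \<longlonglongrightarrow> (\<integral>x. indicator A x \<partial>M)"
      by (rule integral_dominated_convergence[where w="\<lambda>_. 1"]) (use lim f01 in auto)
    moreover have "(\<lambda>n. integral\<^sup>L N (f n)) \<longlonglongrightarrow> (\<integral>x. indicator A x \<partial>N)"
      by (rule integral_dominated_convergence[where w="\<lambda>_. 1"]) (use lim f01 in auto)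
    moreover have "integral\<^sup>L M (f n) = integral\<^sup>L N (f n)" for n
      by (rule eq[OF cont]) (rule f01)+
    ultimately have "(\<integral>x. indicator A x \<partial>M) = (\<integral>x. indicator A x \<partial>N :: real)"
      using LIMSEQ_unique by simp
    then have "measure M A = measure N A"
      by (simp add: space)
    then show ?thesis by (simp add: M.emeasure_eq_measure N.emeasure_eq_measure)
  qed
  show ?thesis
  proof (rule measure_eqI_generator_eq[where E="Collect closed" and \<Omega>=UNIV and A="\<lambda>_. UNIV"])
    show "Int_stable (Collect closed :: 'a set set)" by (auto simp: Int_stable_def)
    show "sets M = sigma_sets UNIV (Collect closed)" "sets N = sigma_sets UNIV (Collect closed)"
      by (simp_all add: sets borel_eq_closed)
    show "emeasure M X = emeasure N X" if "X \<in> Collect closed" for X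
      using that ne[of X] by (cases "X = {}") auto
  qed (auto simp: M.emeasure_eq_measure)
qed

text \<open>Fubini and the addition formula for the cosine. The weight \<open>g\<close> allows two
  uses: \<open>g = 1\<close> for a finite measure, and an integrable function against
  \<open>lborel\<close>.\<close>

lemma integral_integral_cos_normal_measure:
  fixes M :: "'a::euclidean_space measure" and g :: "'a \<Rightarrow> real"
  assumes M: "sigma_finite_measure M" and sets: "sets M = sets borel" and g: "integrable M g" and s: "0 < s"
  shows "(\<integral>x. g x * (\<integral>k. cos (k \<bullet> (x - z)) \<partial>normal_measure s) \<partial>M)
       = (\<integral>k. cos (k \<bullet> z) * (\<integral>x. g x * cos (k \<bullet> x) \<partial>M) + sin (k \<bullet> z) * (\<integral>x. g x * sin (k \<bullet> x) \<partial>M) \<partial>normal_measure s)"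
proof -
  note [measurable_cong] = sets
  have [measurable]: "g \<in> borel_measurable borel"
    using borel_measurable_integrable[OF g] by (simp cong: measurable_cong_sets)
  interpret M: sigma_finite_measure M by fact
  interpret N: prob_space "normal_measure s :: 'a measure" by (rule prob_space_normal_measure) fact
  interpret pair_sigma_finite M "normal_measure s :: 'a measure" ..
  have int: "integrable (M \<Otimes>\<^sub>M normal_measure s) (\<lambda>(x, k). g x * cos (k \<bullet> (x - z)))"
  proof (rule Bochner_Integration.integrable_bound)
    show "integrable (M \<Otimes>\<^sub>M normal_measure s) (\<lambda>(x, k :: 'a). g x * 1)"
      using g N.prob_space by (intro Fubini_integrable) auto
  qed (auto simp: abs_mult intro!: AE_I2 mult_left_le)
  have gi: "integrable M (\<lambda>x. g x * cos (k \<bullet> x))" "integrable M (\<lambda>x. g x * sin (k \<bullet> x))" for k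
    by (rule Bochner_Integration.integrable_bound[OF g]; auto simp: abs_mult intro!: AE_I2 mult_left_le)+
  have "(\<integral>x. g x * (\<integral>k. cos (k \<bullet> (x - z)) \<partial>normal_measure s) \<partial>M)
      = (\<integral>x. (\<integral>k. g x * cos (k \<bullet> (x - z)) \<partial>normal_measure s) \<partial>M)"
    by simp
  also have "\<dots> = (\<integral>k. (\<integral>x. g x * cos (k \<bullet> (x - z)) \<partial>M) \<partial>normal_measure s)"
    using Fubini_integral[OF int] by simp
  also have "(\<lambda>k. \<integral>x. g x * cos (k \<bullet> (x - z)) \<partial>M)
      = (\<lambda>k. \<integral>x. cos (k \<bullet> z) * (g x * cos (k \<bullet> x)) + sin (k \<bullet> z) * (g x * sin (k \<bullet> x)) \<partial>M)"
    by (simp add: inner_diff_right cos_diff algebra_simps)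
  also have "\<dots> = (\<lambda>k. cos (k \<bullet> z) * (\<integral>x. g x * cos (k \<bullet> x) \<partial>M) + sin (k \<bullet> z) * (\<integral>x. g x * sin (k \<bullet> x) \<partial>M))"
    using gi by simp
  finally show ?thesis .
qed

text \<open>The Gaussian smoothing of a measure is an average of its transforms over frequencies, so
  agreement at almost every \<open>k\<close> makes the smoothed measures equal. Moving the smoothing
  onto a continuous test function and shrinking the width recovers the measures themselves.\<close>

lemma finite_measure_eqI_trig:
  fixes M N :: "'a::euclidean_space measure"
  assumes fin: "finite_measure M" "finite_measure N"
    and sets: "sets M = sets borel" "sets N = sets borel"
    and cos: "AE k in lborel. (\<integral>x. cos (k \<bullet> x) \<partial>M) = (\<integral>x. cos (k \<bullet> x) \<partial>N)"
    and sin: "AE k in lborel. (\<integral>x. sin (k \<bullet> x) \<partial>M) = (\<integral>x. sin (k \<bullet> x) \<partial>N)"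
  shows "M = N"
proof (rule finite_measure_eqI_continuous[OF fin sets])
  note [measurable_cong] = sets
  interpret M: finite_measure M by fact
  interpret N: finite_measure N by fact
  have [measurable]: "(\<lambda>k. \<integral>x. cos (k \<bullet> x) \<partial>M) \<in> borel_measurable borel" "(\<lambda>k. \<integral>x. sin (k \<bullet> x) \<partial>M) \<in> borel_measurable borel"
    "(\<lambda>k. \<integral>x. cos (k \<bullet> x) \<partial>N) \<in> borel_measurable borel" "(\<lambda>k. \<integral>x. sin (k \<bullet> x) \<partial>N) \<in> borel_measurable borel"
    by measurable
  have gauss_eq: "(\<integral>x. gauss s (x - z) \<partial>M) = (\<integral>x. gauss s (x - z) \<partial>N)" if s: "0 < s" for s z
  proof -
    have "AE k in normal_measure (1/s). (\<integral>x. cos (k \<bullet> x) \<partial>M) = (\<integral>x. cos (k \<bullet> x) \<partial>N)"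
      "AE k in normal_measure (1/s). (\<integral>x. sin (k \<bullet> x) \<partial>M) = (\<integral>x. sin (k \<bullet> x) \<partial>N)"
      using s cos sin by (simp_all add: AE_normal_measure_iff)
    then have "(\<integral>k. cos (k \<bullet> z) * (\<integral>x. cos (k \<bullet> x) \<partial>M) + sin (k \<bullet> z) * (\<integral>x. sin (k \<bullet> x) \<partial>M) \<partial>normal_measure (1/s))
      = (\<integral>k. cos (k \<bullet> z) * (\<integral>x. cos (k \<bullet> x) \<partial>N) + sin (k \<bullet> z) * (\<integral>x. sin (k \<bullet> x) \<partial>N) \<partial>normal_measure (1/s))"
      by (intro integral_cong_AE) (measurable, auto)
    then have "(\<integral>x. (\<integral>k. cos (k \<bullet> (x - z)) \<partial>normal_measure (1/s)) \<partial>M) = (\<integral>x. (\<integral>k. cos (k \<bullet> (x - z)) \<partial>normal_measure (1/s)) \<partial>N)"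
      using integral_integral_cos_normal_measure[OF M.sigma_finite_measure_axioms sets(1), of "\<lambda>_. 1" "1/s" z]
        integral_integral_cos_normal_measure[OF N.sigma_finite_measure_axioms sets(2), of "\<lambda>_. 1" "1/s" z] s
      by simp
    then show ?thesis
      using s by (simp add: gauss_eq_integral_cos)
  qed
  fix f :: "'a \<Rightarrow> real"
  assume cont: "continuous_on UNIV f" and f0: "\<And>x. 0 \<le> f x" and f1: "\<And>x. f x \<le> 1"
  have f_abs: "\<bar>f x\<bar> \<le> 1" for x using f0[of x] f1[of x] by simp
  have [measurable]: "f \<in> borel_measurable borel"
    using cont by (rule borel_measurable_continuous_onI)
  define m where "m s x = (\<integral>y. f (x + y) \<partial>normal_measure s)" for s x
  have m_measurable: "m s \<in> borel_measurable borel" if "0 < s" for s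
  proof -
    interpret prob_space "normal_measure s :: 'a measure" by (rule prob_space_normal_measure) fact
    show ?thesis unfolding m_def by measurable
  qed
  have m_nonneg: "0 \<le> m s x" for s x
    unfolding m_def using f0 by simp
  have m_abs: "\<bar>m s x\<bar> \<le> 1" if "0 < s" for s x
    unfolding m_def by (rule mollification_bounded[OF that f_abs])
  have m_tendsto: "(\<lambda>n. integral\<^sup>L K (m (1 / real (Suc n)))) \<longlonglongrightarrow> integral\<^sup>L K f"
    if "finite_measure K" and K: "sets K = sets borel" for K
  proof (rule integral_dominated_convergence[where w="\<lambda>_. 1"])
    interpret K: finite_measure K by fact
    note [measurable_cong] = K
    show "AE x in K. (\<lambda>n. m (1 / real (Suc n)) x) \<longlonglongrightarrow> f x"
      unfolding m_def
      by (intro AE_I2 mollification_tendsto[OF cont f_abs] LIMSEQ_Suc lim_1_over_n) simp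
    show "integrable K (\<lambda>_. 1::real)" by simp
    show "f \<in> borel_measurable K" by measurable
    show "m (1 / real (Suc n)) \<in> borel_measurable K" for n
      using m_measurable[of "1 / real (Suc n)"] K
      by (simp cong: measurable_cong_sets)
    show "AE x in K. norm (m (1 / real (Suc n)) x) \<le> 1" for n
      using m_abs[of "1 / real (Suc n)"] by simp
  qed
  \<comment> \<open>Tonelli moves the smoothing from \<open>f\<close> to \<open>K\<close>. The
    integrals are taken in \<open>ennreal\<close> because \<open>f\<close> may fail to be integrable
    over \<open>lborel\<close>.\<close>
  have m_ennreal: "ennreal (integral\<^sup>L K (m s)) = (\<integral>\<^sup>+ u. ennreal (f u) * ennreal (\<integral>x. gauss s (x - u) \<partial>K) \<partial>lborel)"
    if "finite_measure K" and K: "sets K = sets borel" and s: "0 < s" for K s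
  proof -
    interpret K: finite_measure K by fact
    interpret pair_sigma_finite K lborel ..
    interpret P: prob_space "normal_measure s :: 'a measure" by (rule prob_space_normal_measure) fact
    note [measurable_cong] = K
    note [measurable] = m_measurable[OF s]
    have gi: "integrable K (\<lambda>x. gauss s (x - u))" for u
      by (rule K.integrable_const_bound[of _ "1 / sqrt (2 * pi * s\<^sup>2) ^ DIM('a)"])
         (auto simp: gauss_def divide_right_mono)
    have m_nn: "ennreal (m s x) = (\<integral>\<^sup>+ u. ennreal (f u) * ennreal (gauss s (x - u)) \<partial>lborel)" for x
    proof -
      have "ennreal (m s x) = (\<integral>\<^sup>+ y. ennreal (f (x + y)) \<partial>normal_measure s)"
        unfolding m_def
        by (rule nn_integral_eq_integral[symmetric], rule P.integrable_const_bound[of _ 1]) (use f_abs f0 in auto)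
      also have "\<dots> = (\<integral>\<^sup>+ y. ennreal (gauss s y) * ennreal (f (x + y)) \<partial>lborel)"
        unfolding normal_measure_def by (rule nn_integral_density) measurable
      also have "\<dots> = (\<integral>\<^sup>+ u. ennreal (gauss s (u - x)) * ennreal (f u) \<partial>distr lborel borel ((+) x))"
        by (subst nn_integral_distr) auto
      finally show ?thesis by (simp add: lborel_distr_plus gauss_minus_commute[of s x] mult.commute)
    qed
    have "ennreal (integral\<^sup>L K (m s)) = (\<integral>\<^sup>+ x. ennreal (m s x) \<partial>K)"
      by (rule nn_integral_eq_integral[symmetric], rule K.integrable_const_bound[of _ 1])
         (use m_abs[OF s] m_nonneg in auto)
    also have "\<dots> = (\<integral>\<^sup>+ x. (\<integral>\<^sup>+ u. ennreal (f u) * ennreal (gauss s (x - u)) \<partial>lborel) \<partial>K)"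
      by (simp add: m_nn)
    also have "\<dots> = (\<integral>\<^sup>+ u. (\<integral>\<^sup>+ x. ennreal (f u) * ennreal (gauss s (x - u)) \<partial>K) \<partial>lborel)"
      by (rule Fubini'[symmetric]) measurable
    also have "\<dots> = (\<integral>\<^sup>+ u. ennreal (f u) * ennreal (\<integral>x. gauss s (x - u) \<partial>K) \<partial>lborel)"
      using gi by (simp add: nn_integral_cmult nn_integral_eq_integral)
    finally show ?thesis .
  qed
  have "integral\<^sup>L M (m s) = integral\<^sup>L N (m s)" if "0 < s" for s
  proof -
    have "ennreal (integral\<^sup>L M (m s)) = ennreal (integral\<^sup>L N (m s))"
      using that gauss_eq by (simp add: m_ennreal fin sets)
    then show ?thesis using m_nonneg by (simp add: integral_nonneg)
  qed
  then have "(\<lambda>n. integral\<^sup>L M (m (1 / real (Suc n)))) = (\<lambda>n. integral\<^sup>L N (m (1 / real (Suc n))))"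
    by simp
  then show "integral\<^sup>L M f = integral\<^sup>L N f"
    using m_tendsto[OF fin(1) sets(1)] m_tendsto[OF fin(2) sets(2)]
    by (metis LIMSEQ_unique)
qed

section \<open>Comparison of costs of positive type\<close>

lemma nn_integral_exp_square:
  assumes "0 \<le> r"
  shows "(\<integral>\<^sup>+ t. ennreal (exp (- (t * r)\<^sup>2 / 2)) \<partial>lborel) = (if r = 0 then \<infinity> else ennreal (sqrt (2 * pi) / r))"
proof (cases "r = 0")
  case True
  then show ?thesis by simp
next
  case False
  with assms have r: "0 < r" by simp
  have "ennreal (exp (- (t * r)\<^sup>2 / 2)) = ennreal (sqrt (2 * pi) / r) * ennreal (normal_density 0 (1 / r) t)" for t
    using r by (simp add: normal_density_def ennreal_mult[symmetric] power_mult_distrib power_divide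
        real_sqrt_divide real_sqrt_mult divide_simps)
  then have "(\<integral>\<^sup>+ t. ennreal (exp (- (t * r)\<^sup>2 / 2)) \<partial>lborel)
      = ennreal (sqrt (2 * pi) / r) * (\<integral>\<^sup>+ t. ennreal (normal_density 0 (1 / r) t) \<partial>lborel)"
    by (simp add: nn_integral_cmult)
  also have "\<dots> = ennreal (sqrt (2 * pi) / r)"
    using r by (simp add: nn_integral_eq_integral)
  finally show ?thesis using r by simp
qed

text \<open>For \<open>z \<noteq> 0\<close> the integrand is a multiple of the normal density of
  width \<open>1 / norm z\<close>; at the origin it is constantly 1, and its infinite integral
  reproduces the singularity.\<close>

lemma coulomb_eq_gaussian_mixture:
  fixes z :: "'a::real_normed_vector"
  shows "(if z = 0 then \<infinity> else ennreal (1 / norm z))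
    = ennreal (1 / sqrt (2 * pi)) * (\<integral>\<^sup>+ t. ennreal (exp (- (t * norm z)\<^sup>2 / 2)) \<partial>lborel)"
  by (subst nn_integral_exp_square) (simp_all add: ennreal_mult[symmetric] ennreal_mult_top)

lemma abs_integral_cos_le:
  fixes K :: "'a::euclidean_space measure"
  assumes "prob_space K"
  shows "\<bar>\<integral>z. cos (k \<bullet> z) \<partial>K\<bar> \<le> 1"
proof -
  interpret K: prob_space K by fact
  have "\<bar>\<integral>z. cos (k \<bullet> z) \<partial>K\<bar> \<le> (\<integral>z. \<bar>cos (k \<bullet> z)\<bar> \<partial>K)"
    using integral_norm_bound[of K "\<lambda>z. cos (k \<bullet> z)"] by simp
  also have "\<dots> \<le> (\<integral>z. 1 \<partial>K)"
    by (intro integral_mono') auto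
  finally show ?thesis by (simp add: K.prob_space)
qed

text \<open>The Fubini identity \<open>integral_integral_cos_normal_measure\<close> at shift 0,
  where the sine term drops out.\<close>

lemma integral_gaussian_eq:
  fixes K :: "'a::euclidean_space measure"
  assumes s: "0 < s" and K: "prob_space K" "sets K = sets borel"
  shows "(\<integral>z. exp (- (s * norm z)\<^sup>2 / 2) \<partial>K) = (\<integral>k. (\<integral>z. cos (k \<bullet> z) \<partial>K) \<partial>normal_measure s)"
proof -
  interpret K: prob_space K by fact
  show ?thesis
    using integral_integral_cos_normal_measure[OF K.sigma_finite_measure_axioms K(2), of "\<lambda>_. 1" s 0] s
    by (simp add: integral_normal_measure_cos)
qed

lemma nn_integral_coulomb:
  fixes K :: "'a::euclidean_space measure"
  assumes "prob_space K" and K [measurable_cong]: "sets K = sets borel"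
  shows "(\<integral>\<^sup>+ z. (if z = 0 then \<infinity> else ennreal (1 / norm z)) \<partial>K)
    = ennreal (1 / sqrt (2 * pi)) * (\<integral>\<^sup>+ t. (\<integral>\<^sup>+ z. ennreal (exp (- (t * norm z)\<^sup>2 / 2)) \<partial>K) \<partial>lborel)"
proof -
  interpret K: prob_space K by fact
  interpret pair_sigma_finite K "lborel :: real measure" ..
  have "(\<integral>\<^sup>+ z. (if z = 0 then \<infinity> else ennreal (1 / norm z)) \<partial>K)
     = ennreal (1 / sqrt (2 * pi)) * (\<integral>\<^sup>+ z. (\<integral>\<^sup>+ t. ennreal (exp (- (t * norm z)\<^sup>2 / 2)) \<partial>lborel) \<partial>K)"
    by (simp only: coulomb_eq_gaussian_mixture) (rule nn_integral_cmult, measurable)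
  also have "(\<integral>\<^sup>+ z. (\<integral>\<^sup>+ t. ennreal (exp (- (t * norm z)\<^sup>2 / 2)) \<partial>lborel) \<partial>K)
     = (\<integral>\<^sup>+ t. (\<integral>\<^sup>+ z. ennreal (exp (- (t * norm z)\<^sup>2 / 2)) \<partial>K) \<partial>lborel)"
    by (rule Fubini'[symmetric]) measurable
  finally show ?thesis .
qed

section \<open>Two laws ordered by their cosine transforms\<close>

locale spectral_dominance = P: prob_space P + Q: prob_space Q
  for P Q :: "'a::euclidean_space measure" +
  assumes sets_P [measurable_cong, simp]: "sets P = sets borel"
    and sets_Q [measurable_cong, simp]: "sets Q = sets borel"
    and dominance: "\<And>k. (\<integral>z. cos (k \<bullet> z) \<partial>Q) \<le> (\<integral>z. cos (k \<bullet> z) \<partial>P)"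
begin

text \<open>Each cost difference below is an integral of \<open>gap\<close> against nonnegative
  weights, or a limit of such integrals. Cosine transforms suffice because the costs in question are
  even functions.\<close>

definition gap :: "'a \<Rightarrow> real" where
  "gap k = (\<integral>z. cos (k \<bullet> z) \<partial>P) - (\<integral>z. cos (k \<bullet> z) \<partial>Q)"

lemma gap_nonneg: "0 \<le> gap k"
  using dominance by (simp add: gap_def)

lemma borel_measurable_integral_cos [measurable]:
  "(\<lambda>k. \<integral>z. cos (k \<bullet> z) \<partial>P) \<in> borel_measurable borel"
  "(\<lambda>k. \<integral>z. cos (k \<bullet> z) \<partial>Q) \<in> borel_measurable borel"
  by measurable

lemma borel_measurable_gap [measurable]: "gap \<in> borel_measurable borel"
  unfolding gap_def by measurable

lemma abs_gap_le: "\<bar>gap k\<bar> \<le> 2"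
  using abs_integral_cos_le[OF P.prob_space_axioms, of k] abs_integral_cos_le[OF Q.prob_space_axioms, of k]
  by (simp add: gap_def)

lemma gaussian_gap:
  assumes s: "0 < s"
  shows "(\<integral>z. exp (- (s * norm z)\<^sup>2 / 2) \<partial>P) - (\<integral>z. exp (- (s * norm z)\<^sup>2 / 2) \<partial>Q)
    = (\<integral>k. gap k \<partial>normal_measure s)"
proof -
  interpret N: prob_space "normal_measure s :: 'a measure" by (rule prob_space_normal_measure) fact
  have "integrable (normal_measure s) (\<lambda>k. \<integral>z. cos (k \<bullet> z) \<partial>P)"
    "integrable (normal_measure s) (\<lambda>k. \<integral>z. cos (k \<bullet> z) \<partial>Q)"
    by (rule N.integrable_const_bound[of _ 1];
        simp add: abs_integral_cos_le P.prob_space_axioms Q.prob_space_axioms)+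
  then show ?thesis
    unfolding integral_gaussian_eq[OF s P.prob_space_axioms sets_P]
      integral_gaussian_eq[OF s Q.prob_space_axioms sets_Q] gap_def
    by simp
qed

lemma gaussian_le:
  "(\<integral>z. exp (- (t * norm z)\<^sup>2 / 2) \<partial>Q) \<le> (\<integral>z. exp (- (t * norm z)\<^sup>2 / 2) \<partial>P)"
proof (cases "t = 0")
  case True
  then show ?thesis by (simp add: P.prob_space Q.prob_space)
next
  case False
  \<comment> \<open>\<open>gaussian_gap\<close> asks for a positive width, while the Coulomb mixture
    runs over all real \<open>t\<close>; the exponent depends on \<open>t\<close> only through its
    square.\<close>
  have "0 \<le> (\<integral>k. gap k \<partial>normal_measure \<bar>t\<bar>)" by (simp add: gap_nonneg)
  then show ?thesis
    using gaussian_gap[of "\<bar>t\<bar>"] False by (simp add: power_mult_distrib)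
qed

text \<open>A nonnegative function whose integral vanishes against a measure with the same null sets
  as \<open>lborel\<close> is zero almost everywhere.\<close>

lemma gaussian_eqD:
  assumes t: "t \<noteq> 0"
    and eq: "(\<integral>z. exp (- (t * norm z)\<^sup>2 / 2) \<partial>P) = (\<integral>z. exp (- (t * norm z)\<^sup>2 / 2) \<partial>Q)"
  shows "AE k in lborel. gap k = 0"
proof -
  interpret N: prob_space "normal_measure \<bar>t\<bar> :: 'a measure"
    using t by (intro prob_space_normal_measure) simp
  have "(\<integral>k. gap k \<partial>normal_measure \<bar>t\<bar>) = 0"
    using gaussian_gap[of "\<bar>t\<bar>"] t eq by (simp add: power_mult_distrib)
  moreover have "integrable (normal_measure \<bar>t\<bar>) gap"
    by (rule N.integrable_const_bound[of _ 2]) (simp_all add: abs_gap_le)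
  ultimately have "AE k in normal_measure \<bar>t\<bar>. gap k = 0"
    using integral_nonneg_eq_0_iff_AE[of "normal_measure \<bar>t\<bar>" gap] by (simp add: gap_nonneg)
  then show ?thesis using t by (simp add: AE_normal_measure_iff)
qed

lemma nn_integral_gaussian:
  "(\<integral>\<^sup>+ z. ennreal (exp (- (t * norm z)\<^sup>2 / 2)) \<partial>P) = ennreal (\<integral>z. exp (- (t * norm z)\<^sup>2 / 2) \<partial>P)"
  "(\<integral>\<^sup>+ z. ennreal (exp (- (t * norm z)\<^sup>2 / 2)) \<partial>Q) = ennreal (\<integral>z. exp (- (t * norm z)\<^sup>2 / 2) \<partial>Q)"
  by (rule nn_integral_eq_integral, rule P.integrable_const_bound[of _ 1]; simp)
     (rule nn_integral_eq_integral, rule Q.integrable_const_bound[of _ 1]; simp)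

lemma coulomb_le:
  "(\<integral>\<^sup>+ z. (if z = 0 then \<infinity> else ennreal (1 / norm z)) \<partial>Q) \<le> (\<integral>\<^sup>+ z. (if z = 0 then \<infinity> else ennreal (1 / norm z)) \<partial>P)"
  by (simp only: nn_integral_coulomb P.prob_space_axioms Q.prob_space_axioms sets_P sets_Q nn_integral_gaussian)
     (intro mult_left_mono nn_integral_mono ennreal_leI gaussian_le; simp)

text \<open>Finiteness of the cost permits subtracting the two mixtures. The difference is
  nonnegative with zero integral, so the Gaussian expectations agree for almost every
  \<open>t\<close>, and a single nonzero \<open>t\<close> is enough for
  \<open>gaussian_eqD\<close>.\<close>

lemma coulomb_eqD:
  assumes eq: "(\<integral>\<^sup>+ z. (if z = 0 then \<infinity> else ennreal (1 / norm z)) \<partial>P) = (\<integral>\<^sup>+ z. (if z = 0 then \<infinity> else ennreal (1 / norm z)) \<partial>Q)"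
    and fin: "(\<integral>\<^sup>+ z. (if z = 0 then \<infinity> else ennreal (1 / norm z)) \<partial>Q) < \<infinity>"
  shows "AE k in lborel. gap k = 0"
proof -
  define u v where "u t = (\<integral>z. exp (- (t * norm z)\<^sup>2 / 2) \<partial>P)" and "v t = (\<integral>z. exp (- (t * norm z)\<^sup>2 / 2) \<partial>Q)" for t
  have [measurable]: "u \<in> borel_measurable borel" "v \<in> borel_measurable borel"
    unfolding u_def v_def by measurable
  have c: "ennreal (1 / sqrt (2 * pi)) \<noteq> 0" "ennreal (1 / sqrt (2 * pi)) \<noteq> \<infinity>" by auto
  have eq': "(\<integral>\<^sup>+ t. ennreal (u t) \<partial>lborel) = (\<integral>\<^sup>+ t. ennreal (v t) \<partial>lborel)"
    using eq c
    by (simp only: nn_integral_coulomb P.prob_space_axioms Q.prob_space_axioms sets_P sets_Q nn_integral_gaussian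
        u_def[symmetric] v_def[symmetric] ennreal_mult_cancel_left) simp
  have fin': "(\<integral>\<^sup>+ t. ennreal (v t) \<partial>lborel) \<noteq> \<infinity>"
    using fin c
    by (simp only: nn_integral_coulomb P.prob_space_axioms Q.prob_space_axioms sets_P sets_Q nn_integral_gaussian
        u_def[symmetric] v_def[symmetric]) (auto simp: ennreal_mult_top)
  have le: "v t \<le> u t" for t unfolding u_def v_def by (rule gaussian_le)
  have "(\<integral>\<^sup>+ t. (ennreal (u t) - ennreal (v t)) \<partial>lborel) = 0"
    using fin' eq' le by (subst nn_integral_diff) (auto intro: ennreal_leI)
  then have "AE t in lborel. ennreal (u t) - ennreal (v t) = 0"
    by (subst (asm) nn_integral_0_iff_AE) auto
  \<comment> \<open>At \<open>t = 0\<close> both expectations are 1 and carry no information on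
    \<open>gap\<close>.\<close>
  moreover have "AE t in lborel. t \<noteq> (0::real)" by (rule AE_lborel_singleton)
  ultimately have "AE t in lborel. t \<noteq> 0 \<and> u t \<le> v t"
  proof eventually_elim
    case (elim t)
    have "0 \<le> v t" by (simp add: v_def)
    with elim show ?case by (simp add: ennreal_minus ennreal_eq_0_iff)
  qed
  moreover have "ae_filter (lborel :: real measure) \<noteq> bot"
    by (simp add: ae_filter_eq_bot_iff)
  ultimately obtain t where "t \<noteq> 0" "u t \<le> v t"
    using eventually_happens' by blast
  with le[of t] show ?thesis
    by (intro gaussian_eqD[of t]) (auto simp: u_def v_def)
qed

text \<open>A Parseval identity. The transform \<open>F\<close> is only known to be bounded;
  mollifying \<open>f\<close> multiplies it by a Gaussian, which makes the integral over frequencies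
  converge.\<close>

lemma mollified_gap:
  fixes f F :: "'a \<Rightarrow> real"
  assumes f: "integrable lborel f" and cont: "continuous_on UNIV f"
    and cos: "\<And>k. (\<integral>u. f u * cos (k \<bullet> u) \<partial>lborel) = F k"
    and sin: "\<And>k. (\<integral>u. f u * sin (k \<bullet> u) \<partial>lborel) = 0"
    and s: "0 < s"
  shows "(\<integral>z. (\<integral>y. f (z + y) \<partial>normal_measure s) \<partial>P) - (\<integral>z. (\<integral>y. f (z + y) \<partial>normal_measure s) \<partial>Q)
     = (\<integral>k. exp (- (s * norm k)\<^sup>2 / 2) / (2 * pi) ^ DIM('a) * F k * gap k \<partial>lborel)"
    and "integrable lborel (\<lambda>k. exp (- (s * norm k)\<^sup>2 / 2) / (2 * pi) ^ DIM('a) * F k * gap k)"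
proof -
  have [measurable]: "f \<in> borel_measurable borel"
    using cont by (rule borel_measurable_continuous_onI)
  have F_eq: "F = (\<lambda>k. \<integral>u. f u * cos (k \<bullet> u) \<partial>lborel)" using cos by auto
  have [measurable]: "F \<in> borel_measurable borel" unfolding F_eq by measurable
  define A where "A = (\<integral>u. \<bar>f u\<bar> \<partial>lborel)"
  have F_le: "\<bar>F k\<bar> \<le> A" for k
  proof -
    have "\<bar>F k\<bar> \<le> (\<integral>u. \<bar>f u * cos (k \<bullet> u)\<bar> \<partial>lborel)"
      unfolding cos[symmetric] using integral_norm_bound[of lborel "\<lambda>u. f u * cos (k \<bullet> u)"] by simp
    also have "\<dots> \<le> A"
      unfolding A_def using f by (intro integral_mono') (auto simp: abs_mult intro!: mult_left_le)
    finally show ?thesis .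
  qed
  define c where "c = 1 / sqrt (2 * pi * s\<^sup>2) ^ DIM('a)"
  interpret N: prob_space "normal_measure (1 / s) :: 'a measure"
    using s by (intro prob_space_normal_measure) simp
  \<comment> \<open>Fourier inversion with a Gaussian cutoff; the sine part vanishes by
    \<open>sin\<close>.\<close>
  have m: "(\<integral>y. f (z + y) \<partial>normal_measure s) = c * (\<integral>k. F k * cos (k \<bullet> z) \<partial>normal_measure (1 / s))" for z
  proof -
    have "(\<integral>y. f (z + y) \<partial>normal_measure s) = c * (\<integral>u. f u * (\<integral>k. cos (k \<bullet> (u - z)) \<partial>normal_measure (1 / s)) \<partial>lborel)"
      using s by (simp add: integral_normal_measure_shift gauss_eq_integral_cos c_def mult.commute)
    also have "(\<integral>u. f u * (\<integral>k. cos (k \<bullet> (u - z)) \<partial>normal_measure (1 / s)) \<partial>lborel) = (\<integral>k. F k * cos (k \<bullet> z) \<partial>normal_measure (1 / s))"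
      using s by (subst integral_integral_cos_normal_measure)
        (simp_all add: f cos sin sigma_finite_lborel mult.commute)
    finally show ?thesis .
  qed
  have mK: "(\<integral>z. (\<integral>y. f (z + y) \<partial>normal_measure s) \<partial>K) = c * (\<integral>k. F k * (\<integral>z. cos (k \<bullet> z) \<partial>K) \<partial>normal_measure (1 / s))"
    if "prob_space K" and K: "sets K = sets borel" for K
  proof -
    interpret K: prob_space K by fact
    note [measurable_cong] = K
    interpret pair_sigma_finite K "normal_measure (1 / s) :: 'a measure" ..
    interpret KN: pair_prob_space K "normal_measure (1 / s) :: 'a measure" ..
    have int: "integrable (K \<Otimes>\<^sub>M normal_measure (1 / s)) (\<lambda>(z, k). F k * cos (k \<bullet> z))"
      by (rule KN.P.integrable_const_bound[of _ A])
         (auto intro!: AE_I2 order_trans[OF mult_left_le F_le] simp: abs_mult)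
    show ?thesis
      using Fubini_integral[OF int] by (simp add: m)
  qed
  have iK: "integrable (normal_measure (1 / s)) (\<lambda>k. F k * (\<integral>z. cos (k \<bullet> z) \<partial>P))"
     "integrable (normal_measure (1 / s)) (\<lambda>k. F k * (\<integral>z. cos (k \<bullet> z) \<partial>Q))"
    by (rule N.integrable_const_bound[of _ A];
        auto intro!: AE_I2 order_trans[OF mult_left_le F_le] abs_integral_cos_le
          simp: abs_mult P.prob_space_axioms Q.prob_space_axioms)+
  then have iG: "integrable (normal_measure (1 / s)) (\<lambda>k. F k * gap k)"
    by (simp add: gap_def right_diff_distrib)
  \<comment> \<open>The normalising constants for the widths \<open>s\<close> and
    \<open>1 / s\<close> multiply to \<open>(2 * pi) ^ DIM('a)\<close>, the constant of Fourier
    inversion.\<close>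
  have w: "c * gauss (1 / s) k = exp (- (s * norm k)\<^sup>2 / 2) / (2 * pi) ^ DIM('a)" for k :: 'a
  proof -
    have "sqrt (2 * pi * s\<^sup>2) * sqrt (2 * pi * (1 / s)\<^sup>2) = sqrt ((2 * pi)\<^sup>2)"
      using s by (simp add: real_sqrt_mult[symmetric] power_divide power2_eq_square)
    then have "sqrt (2 * pi * s\<^sup>2) * sqrt (2 * pi * (1 / s)\<^sup>2) = 2 * pi"
      by (simp only: real_sqrt_abs) simp
    then have "sqrt (2 * pi * s\<^sup>2) ^ DIM('a) * sqrt (2 * pi * (1 / s)\<^sup>2) ^ DIM('a) = (2 * pi) ^ DIM('a)"
      by (simp only: power_mult_distrib[symmetric])
    moreover have "- (norm k)\<^sup>2 / (2 * (1 / s)\<^sup>2) = - (s * norm k)\<^sup>2 / 2"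
      by (simp add: power_mult_distrib power_divide)
    ultimately show ?thesis
      by (simp only: c_def gauss_def times_divide_times_eq mult_1)
  qed
  have "integrable lborel (\<lambda>k. gauss (1 / s) k * (F k * gap k))"
    using iG unfolding normal_measure_def by (subst (asm) integrable_density) auto
  then have "integrable lborel (\<lambda>k. c * (gauss (1 / s) k * (F k * gap k)))"
    by simp
  then show "integrable lborel (\<lambda>k. exp (- (s * norm k)\<^sup>2 / 2) / (2 * pi) ^ DIM('a) * F k * gap k)"
    by (simp only: w[symmetric] mult.assoc)
  have "(\<integral>z. (\<integral>y. f (z + y) \<partial>normal_measure s) \<partial>P) - (\<integral>z. (\<integral>y. f (z + y) \<partial>normal_measure s) \<partial>Q)
      = c * (\<integral>k. F k * gap k \<partial>normal_measure (1 / s))"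
    using iK by (simp add: mK P.prob_space_axioms Q.prob_space_axioms gap_def right_diff_distrib)
  also have "\<dots> = c * (\<integral>k. gauss (1 / s) k * (F k * gap k) \<partial>lborel)"
    unfolding normal_measure_def by (subst integral_density) auto
  also have "\<dots> = (\<integral>k. c * (gauss (1 / s) k * (F k * gap k)) \<partial>lborel)"
    by simp
  also have "\<dots> = (\<integral>k. exp (- (s * norm k)\<^sup>2 / 2) / (2 * pi) ^ DIM('a) * F k * gap k \<partial>lborel)"
    by (simp only: w[symmetric] mult.assoc)
  finally show "(\<integral>z. (\<integral>y. f (z + y) \<partial>normal_measure s) \<partial>P) - (\<integral>z. (\<integral>y. f (z + y) \<partial>normal_measure s) \<partial>Q) = \<dots>" .
qed

lemma mollified_gap_tendsto:
  fixes f :: "'a \<Rightarrow> real"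
  assumes cont: "continuous_on UNIV f" and bdd: "\<And>x. \<bar>f x\<bar> \<le> B"
  shows "(\<lambda>n. (\<integral>z. (\<integral>y. f (z + y) \<partial>normal_measure (1 / real (Suc n))) \<partial>P) - (\<integral>z. (\<integral>y. f (z + y) \<partial>normal_measure (1 / real (Suc n))) \<partial>Q))
    \<longlonglongrightarrow> integral\<^sup>L P f - integral\<^sup>L Q f"
proof -
  have [measurable]: "f \<in> borel_measurable borel"
    using cont by (rule borel_measurable_continuous_onI)
  have *: "(\<lambda>n. \<integral>z. (\<integral>y. f (z + y) \<partial>normal_measure (1 / real (Suc n))) \<partial>K) \<longlonglongrightarrow> integral\<^sup>L K f"
    if "prob_space K" and K: "sets K = sets borel" for K
  proof (rule integral_dominated_convergence[where w="\<lambda>_. B"])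
    interpret K: prob_space K by fact
    note [measurable_cong] = K
    show "AE x in K. (\<lambda>n. \<integral>y. f (x + y) \<partial>normal_measure (1 / real (Suc n))) \<longlonglongrightarrow> f x"
      by (intro AE_I2 mollification_tendsto[OF cont bdd] LIMSEQ_Suc lim_1_over_n) simp
    show "integrable K (\<lambda>_. B)" by simp
    show "f \<in> borel_measurable K" by measurable
    fix n
    interpret N: prob_space "normal_measure (1 / real (Suc n)) :: 'a measure"
      by (rule prob_space_normal_measure) simp
    show "(\<lambda>z. \<integral>y. f (z + y) \<partial>normal_measure (1 / real (Suc n))) \<in> borel_measurable K" 
      by measurable
    show "AE x in K. norm (\<integral>y. f (x + y) \<partial>normal_measure (1 / real (Suc n))) \<le> B"
      using mollification_bounded[of "1 / real (Suc n)" f B] bdd by simp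
  qed
  show ?thesis
    by (intro tendsto_diff *) (simp_all add: P.prob_space_axioms Q.prob_space_axioms)
qed

text \<open>Every mollified gap is an integral of a nonnegative function, and the sign survives the
  limit of vanishing width.\<close>

lemma positive_type_le:
  fixes f F :: "'a \<Rightarrow> real"
  assumes f: "integrable lborel f" and cont: "continuous_on UNIV f" and bdd: "\<And>x. \<bar>f x\<bar> \<le> B"
    and cos: "\<And>k. (\<integral>u. f u * cos (k \<bullet> u) \<partial>lborel) = F k"
    and sin: "\<And>k. (\<integral>u. f u * sin (k \<bullet> u) \<partial>lborel) = 0"
    and F: "\<And>k. 0 \<le> F k"
  shows "integral\<^sup>L Q f \<le> integral\<^sup>L P f"
proof -
  have "0 \<le> integral\<^sup>L P f - integral\<^sup>L Q f"
    by (rule LIMSEQ_le_const[OF mollified_gap_tendsto[OF cont bdd]])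
       (simp add: mollified_gap(1)[OF f cont cos sin] F gap_nonneg)
  then show ?thesis by simp
qed

text \<open>The mollified gaps increase to \<open>\<integral>f dP - \<integral>f dQ\<close> as the width decreases, so each of them vanishes.\<close>
lemma positive_type_eqD:
  fixes f F :: "'a \<Rightarrow> real"
  assumes f: "integrable lborel f" and cont: "continuous_on UNIV f" and bdd: "\<And>x. \<bar>f x\<bar> \<le> B"
    and cos: "\<And>k. (\<integral>u. f u * cos (k \<bullet> u) \<partial>lborel) = F k"
    and sin: "\<And>k. (\<integral>u. f u * sin (k \<bullet> u) \<partial>lborel) = 0"
    and F: "\<And>k. 0 < F k"
    and eq: "integral\<^sup>L P f = integral\<^sup>L Q f"
  shows "AE k in lborel. gap k = 0"
proof -
  note mg = mollified_gap[OF f cont cos sin]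
  define w where "w s k = exp (- (s * norm k)\<^sup>2 / 2) / (2 * pi) ^ DIM('a) * F k * gap k" for s and k :: 'a
  have F0: "0 \<le> F k" for k using F[of k] by simp
  have w_nonneg: "0 \<le> w s k" for s k by (simp add: w_def F0 gap_nonneg)
  have w_mono: "w 1 k \<le> w s k" if "0 < s" "s \<le> 1" for s k
  proof -
    have "(s * norm k)\<^sup>2 \<le> (1 * norm k)\<^sup>2"
      using that by (intro power_mono mult_right_mono) auto
    then show ?thesis
      unfolding w_def by (intro mult_right_mono divide_right_mono) (auto simp: F0 gap_nonneg)
  qed
  have w_int: "integrable lborel (w s)" if "0 < s" for s
    unfolding w_def[abs_def] using mg(2)[OF that] .
  \<comment> \<open>Width 1 has the smallest weight among the widths
    \<open>1 / real (Suc n)\<close>, so its integral lies below a sequence that tends to 0.\<close>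
  have "integral\<^sup>L lborel (w 1) \<le> 0"
  proof (rule LIMSEQ_le_const)
    show "(\<lambda>n. integral\<^sup>L lborel (w (1 / real (Suc n)))) \<longlonglongrightarrow> 0"
    proof -
      have "integral\<^sup>L lborel (w (1 / real (Suc n)))
          = (\<integral>z. (\<integral>y. f (z + y) \<partial>normal_measure (1 / real (Suc n))) \<partial>P) - (\<integral>z. (\<integral>y. f (z + y) \<partial>normal_measure (1 / real (Suc n))) \<partial>Q)" for n
        unfolding w_def[abs_def] by (rule mg(1)[symmetric]) simp
      then show ?thesis
        using mollified_gap_tendsto[OF cont bdd] eq by simp
    qed
    show "\<exists>N. \<forall>n\<ge>N. integral\<^sup>L lborel (w 1) \<le> integral\<^sup>L lborel (w (1 / real (Suc n)))"
      by (intro exI[of _ 0] allI impI integral_mono w_int w_mono) auto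
  qed
  moreover have "0 \<le> integral\<^sup>L lborel (w 1)" by (simp add: w_nonneg)
  moreover have "integrable lborel (w 1)" by (simp add: w_int)
  ultimately have "AE k in lborel. w 1 k = 0"
    using integral_nonneg_eq_0_iff_AE[of lborel "w 1"] w_nonneg by simp
  then show ?thesis
  proof eventually_elim
    case (elim k)
    with F[of k] show ?case by (simp add: w_def)
  qed
qed

end

section \<open>Exchangeable sequences\<close>

lemma (in prob_space) expectation_square_sum_equicorrelated:
  fixes Y :: "nat \<Rightarrow> 'a \<Rightarrow> real"
  assumes [measurable]: "\<And>i. Y i \<in> borel_measurable M" and bdd: "\<And>i x. \<bar>Y i x\<bar> \<le> B"
    and var: "\<And>i. expectation (\<lambda>x. Y i x * Y i x) = v"
    and cov: "\<And>i j. i \<noteq> j \<Longrightarrow> expectation (\<lambda>x. Y i x * Y j x) = q"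
  shows "expectation (\<lambda>x. (\<Sum>i<N. Y i x)\<^sup>2) = real N * (v + (real N - 1) * q)"
proof -
  have int: "integrable M (\<lambda>x. Y i x * Y j x)" for i j
    by (rule integrable_const_bound[of _ "B * B"])
       (use bdd order_trans[OF abs_ge_zero bdd] in \<open>auto simp: abs_mult intro!: mult_mono\<close>)
  have "expectation (\<lambda>x. (\<Sum>i<N. Y i x)\<^sup>2) = expectation (\<lambda>x. \<Sum>i<N. \<Sum>j<N. Y i x * Y j x)"
    by (simp add: power2_eq_square sum_product)
  also have "\<dots> = (\<Sum>i<N. \<Sum>j<N. expectation (\<lambda>x. Y i x * Y j x))"
    using int by simp
  \<comment> \<open>Each entry is the constant \<open>q\<close> plus a correction
    \<open>v - q\<close> on the diagonal, so the double sum splits without separating off the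
    diagonal terms.\<close>
  also have "\<dots> = (\<Sum>i<N. \<Sum>j<N. (if j = i then v - q else 0) + q)"
    by (intro sum.cong refl) (auto simp: var cov)
  also have "\<dots> = real N * (v + (real N - 1) * q)"
    by (simp add: sum.distrib algebra_simps)
  finally show ?thesis .
qed

lemma (in prob_space) equicorrelated_cov_nonneg:
  fixes Y :: "nat \<Rightarrow> 'a \<Rightarrow> real"
  assumes meas: "\<And>i. Y i \<in> borel_measurable M" and bdd: "\<And>i x. \<bar>Y i x\<bar> \<le> B"
    and var: "\<And>i. expectation (\<lambda>x. Y i x * Y i x) = v"
    and cov: "\<And>i j. i \<noteq> j \<Longrightarrow> expectation (\<lambda>x. Y i x * Y j x) = q"
  shows "0 \<le> q"
proof (rule ccontr)
  assume "\<not> 0 \<le> q"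
  then have q: "0 < - q" by simp
  obtain N :: nat where N: "v < real N * (- q)"
    using q ex_less_of_nat_mult by blast
  \<comment> \<open>\<open>Suc N\<close> terms are summed so that the leading factor is positive and
    can be cancelled, and so that the coefficient of \<open>q\<close> becomes exactly
    \<open>N\<close>.\<close>
  have "0 \<le> expectation (\<lambda>x. (\<Sum>i<Suc N. Y i x)\<^sup>2)" by simp
  also have "\<dots> = real (Suc N) * (v + (real (Suc N) - 1) * q)"
    by (rule expectation_square_sum_equicorrelated[OF meas bdd var cov])
  finally have "0 \<le> v + real N * q" by (simp add: zero_le_mult_iff)
  with N show False by simp
qed

text \<open>For uncorrelated \<open>Y\<^sub>i\<close>, expanding \<open>0 \<le> E (Y\<^sub>1 + \<dots> + Y\<^sub>N - N r X)\<^sup>2\<close> gives \<open>N r\<^sup>2 \<le> v\<close> for every \<open>N\<close>.\<close>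
lemma (in prob_space) uncorrelated_orthogonal:
  fixes Y :: "nat \<Rightarrow> 'a \<Rightarrow> real" and X :: "'a \<Rightarrow> real"
  assumes meas [measurable]: "\<And>i. Y i \<in> borel_measurable M" and bdd: "\<And>i x. \<bar>Y i x\<bar> \<le> B"
    and var: "\<And>i. expectation (\<lambda>x. Y i x * Y i x) = v"
    and cov: "\<And>i j. i \<noteq> j \<Longrightarrow> expectation (\<lambda>x. Y i x * Y j x) = 0"
    and X [measurable]: "X \<in> borel_measurable M" and X_bdd: "\<And>x. \<bar>X x\<bar> \<le> 1"
    and XY: "\<And>i. expectation (\<lambda>x. X x * Y i x) = r"
  shows "r = 0"
proof (rule ccontr)
  assume "r \<noteq> 0"
  then have r: "0 < r\<^sup>2" by simp
  obtain N :: nat where N: "v < real N * r\<^sup>2" 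
    using r ex_less_of_nat_mult by blast
  have B: "0 \<le> B" using order_trans[OF abs_ge_zero bdd] .
  have iXY: "integrable M (\<lambda>x. X x * Y i x)" for i
  proof (rule integrable_const_bound[of _ "1 * B"])
    show "AE x in M. norm (X x * Y i x) \<le> 1 * B"
      unfolding real_norm_def abs_mult using bdd X_bdd by (intro AE_I2 mult_mono) auto
  qed measurable
  have S_bdd: "\<bar>\<Sum>i<n. Y i x\<bar> \<le> real n * B" for n x
    using order_trans[OF sum_abs sum_bounded_above[of "{..<n}" "\<lambda>i. \<bar>Y i x\<bar>" B]] bdd by simp
  have iSS: "integrable M (\<lambda>x. (\<Sum>i<n. Y i x)\<^sup>2)" for n
    by (rule integrable_const_bound[of _ "(real n * B)\<^sup>2"])
       (use S_bdd in \<open>auto simp: abs_le_square_iff[symmetric] B abs_mult\<close>)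
  have iXX: "integrable M (\<lambda>x. (X x)\<^sup>2)"
    by (rule integrable_const_bound[of _ 1]) (use X_bdd in \<open>auto simp: abs_square_le_1\<close>)
  have XX: "expectation (\<lambda>x. (X x)\<^sup>2) \<le> 1"
    using integral_mono[OF iXX, of "\<lambda>_. 1"] X_bdd by (simp add: abs_square_le_1 prob_space)
  define n where "n = Suc N"
  \<comment> \<open>With this \<open>c\<close> the cross term is \<open>- 2 * c * c\<close>. The
    second moment of \<open>X\<close> is at most 1, so the square term gives back at most
    \<open>c * c\<close>; what remains is negative and quadratic in \<open>n\<close>, against the
    linear \<open>n * v\<close>.\<close>
  define c where "c = real n * r"
  have "0 \<le> expectation (\<lambda>x. ((\<Sum>i<n. Y i x) - c * X x)\<^sup>2)" by simp
  also have "(\<lambda>x. ((\<Sum>i<n. Y i x) - c * X x)\<^sup>2)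
      = (\<lambda>x. (\<Sum>i<n. Y i x)\<^sup>2 - (2 * c) * (\<Sum>i<n. X x * Y i x) + c\<^sup>2 * (X x)\<^sup>2)"
    by (rule ext) (simp add: power2_diff power_mult_distrib sum_distrib_left sum_distrib_right mult.commute mult.left_commute)
  also have "expectation \<dots> = expectation (\<lambda>x. (\<Sum>i<n. Y i x)\<^sup>2) - (2 * c) * (\<Sum>i<n. expectation (\<lambda>x. X x * Y i x))
      + c\<^sup>2 * expectation (\<lambda>x. (X x)\<^sup>2)"
    using iXY iSS iXX by simp
  also have "\<dots> = real n * v - 2 * c * c + c\<^sup>2 * expectation (\<lambda>x. (X x)\<^sup>2)"
    using expectation_square_sum_equicorrelated[OF meas bdd var cov, of "\<lambda>i. i" n] 
    by (simp add: XY c_def)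
  also have "\<dots> \<le> real n * v - 2 * c * c + c\<^sup>2 * 1"
    using XX by (intro add_left_mono mult_left_mono) auto
  also have "\<dots> = real n * (v - real n * r\<^sup>2)"
    by (simp add: c_def power2_eq_square algebra_simps)
  finally have "real n * r\<^sup>2 \<le> v" by (simp add: zero_le_mult_iff n_def)
  moreover have "real N * r\<^sup>2 \<le> real n * r\<^sup>2" by (simp add: n_def mult_right_mono)
  ultimately show False using N by simp
qed

section \<open>Expectations under exchangeable measures\<close>

locale exchangeable = prob_space \<gamma> for \<gamma> :: "(nat \<Rightarrow> real^'d) measure" +
  assumes sets_seq [measurable_cong]: "sets \<gamma> = sets seq_space"
    and sym: "symmetric_meas \<gamma>"
begin

lemma expectation_permute:
  fixes h :: "(nat \<Rightarrow> real^'d) \<Rightarrow> real"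
  assumes "finite I" "\<sigma> permutes I" and [measurable]: "h \<in> borel_measurable (PiM I (\<lambda>_. borel))"
  shows "expectation (\<lambda>x. h (\<lambda>i\<in>I. x (\<sigma> i))) = expectation (\<lambda>x. h (\<lambda>i\<in>I. x i))"
proof -
  have eq: "distr \<gamma> (PiM I (\<lambda>_. borel)) (\<lambda>x. restrict (x \<circ> \<sigma>) I) = distr \<gamma> (PiM I (\<lambda>_. borel)) (\<lambda>x. restrict x I)"
    using sym assms(1,2) unfolding symmetric_meas_def by blast
  have "expectation (\<lambda>x. h (\<lambda>i\<in>I. x (\<sigma> i))) = integral\<^sup>L (distr \<gamma> (PiM I (\<lambda>_. borel)) (\<lambda>x. restrict (x \<circ> \<sigma>) I)) h"
    by (subst integral_distr) (auto simp: comp_def)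
  also have "\<dots> = expectation (\<lambda>x. h (\<lambda>i\<in>I. x i))"
    by (subst eq, subst integral_distr) auto
  finally show ?thesis .
qed

lemma expectation_coordinate:
  fixes \<phi> :: "real^'d \<Rightarrow> real"
  assumes [measurable]: "\<phi> \<in> borel_measurable borel"
  shows "expectation (\<lambda>x. \<phi> (x i)) = expectation (\<lambda>x. \<phi> (x 0))"
proof -
  have "(\<lambda>y. \<phi> (y 0)) \<in> borel_measurable (PiM {0, i} (\<lambda>_. borel))" by measurable
  from expectation_permute[OF _ permutes_swap_id this, of 0 i] show ?thesis by simp
qed

lemma expectation_two_coordinates:
  fixes \<phi> \<psi> :: "real^'d \<Rightarrow> real"
  assumes [measurable]: "\<phi> \<in> borel_measurable borel" "\<psi> \<in> borel_measurable borel" and ij: "i \<noteq> j"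
  shows "expectation (\<lambda>x. \<phi> (x i) * \<psi> (x j)) = expectation (\<lambda>x. \<phi> (x 0) * \<psi> (x 1))"
proof -
  \<comment> \<open>The permutation must send 0 to \<open>i\<close> and 1 to \<open>j\<close>. Here
    \<open>k\<close> is the preimage of \<open>j\<close> under the swap of 0 and \<open>i\<close>;
    since \<open>i \<noteq> j\<close> it is not 0, so the inner swap of 1 and \<open>k\<close>
    leaves 0 fixed.\<close>
  define k where "k = Transposition.transpose 0 i j"
  define \<sigma> where "\<sigma> = Transposition.transpose 0 i \<circ> Transposition.transpose 1 k"
  have k: "k \<noteq> 0" using ij by (auto simp: k_def Transposition.transpose_def)
  have \<sigma>: "\<sigma> 0 = i" "\<sigma> 1 = j"
    using k by (auto simp: \<sigma>_def k_def)
  have p: "\<sigma> permutes {0, 1, i, j}"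
    unfolding \<sigma>_def k_def by (intro permutes_compose permutes_swap_id) (auto simp: Transposition.transpose_def)
  have "(\<lambda>y. \<phi> (y 0) * \<psi> (y 1)) \<in> borel_measurable (PiM {0, 1, i, j} (\<lambda>_. borel))" by measurable
  from expectation_permute[OF _ p this] show ?thesis by (simp add: \<sigma>[unfolded One_nat_def])
qed

text \<open>The swap of \<open>n\<close> and \<open>m\<close> fixes every index below
  \<open>n\<close>, hence the cylinder. An event in the first \<open>n\<close> coordinates therefore
  correlates equally with all later ones.\<close>

lemma expectation_cylinder_coordinate:
  fixes \<phi> :: "real^'d \<Rightarrow> real"
  assumes [measurable]: "\<phi> \<in> borel_measurable borel" "\<And>i. A i \<in> sets borel" and m: "n \<le> m"
  shows "expectation (\<lambda>x. (\<Prod>i<n. indicator (A i) (x i)) * \<phi> (x m)) = expectation (\<lambda>x. (\<Prod>i<n. indicator (A i) (x i)) * \<phi> (x n))"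
proof -
  have [measurable]: "(\<lambda>y. y n) \<in> PiM {..m} (\<lambda>_. borel :: (real^'d) measure) \<rightarrow>\<^sub>M borel"
    "\<And>i. i \<in> {..<n} \<Longrightarrow> (\<lambda>y. y i) \<in> PiM {..m} (\<lambda>_. borel :: (real^'d) measure) \<rightarrow>\<^sub>M borel"
    using m by (auto intro!: measurable_component_singleton)
  have "(\<lambda>y. (\<Prod>i<n. indicator (A i) (y i)) * \<phi> (y n)) \<in> borel_measurable (PiM {..m} (\<lambda>_. borel))"
    by measurable
  moreover have "Transposition.transpose n m permutes {..m}" using m by (intro permutes_swap_id) auto
  ultimately have "expectation (\<lambda>x. (\<Prod>i<n. indicator (A i) ((\<lambda>i\<in>{..m}. x (Transposition.transpose n m i)) i)) * \<phi> ((\<lambda>i\<in>{..m}. x (Transposition.transpose n m i)) n))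
     = expectation (\<lambda>x. (\<Prod>i<n. indicator (A i) ((\<lambda>i\<in>{..m}. x i) i)) * \<phi> ((\<lambda>i\<in>{..m}. x i) n))"
    by (intro expectation_permute) auto
  moreover have "(\<Prod>i<n. indicator (A i) ((\<lambda>i\<in>{..m}. x (Transposition.transpose n m i)) i)) = (\<Prod>i<n. indicator (A i) (x i) :: real)" for x
    using m by (intro prod.cong) auto
  moreover have "(\<Prod>i<n. indicator (A i) ((\<lambda>i\<in>{..m}. x i) i)) = (\<Prod>i<n. indicator (A i) (x i) :: real)" for x
    using m by (intro prod.cong) auto
  ultimately show ?thesis using m by simp
qed

lemma covariance_centered:
  fixes \<phi> :: "real^'d \<Rightarrow> real"
  assumes [measurable]: "\<phi> \<in> borel_measurable borel" and bdd: "\<And>x. \<bar>\<phi> x\<bar> \<le> B"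
  defines "a \<equiv> expectation (\<lambda>x. \<phi> (x 0))"
  shows "expectation (\<lambda>x. (\<phi> (x 0) - a) * (\<phi> (x 1) - a)) = expectation (\<lambda>x. \<phi> (x 0) * \<phi> (x 1)) - a\<^sup>2"
proof -
  have i1: "integrable \<gamma> (\<lambda>x. \<phi> (x i))" for i
    by (rule integrable_const_bound[of _ B]) (use bdd in auto)
  have i2: "integrable \<gamma> (\<lambda>x. \<phi> (x 0) * \<phi> (x 1))"
    by (rule integrable_const_bound[of _ "B * B"])
       (use bdd order_trans[OF abs_ge_zero bdd] in \<open>auto simp: abs_mult intro!: mult_mono\<close>)
  have "expectation (\<lambda>x. (\<phi> (x 0) - a) * (\<phi> (x 1) - a))
     = expectation (\<lambda>x. \<phi> (x 0) * \<phi> (x 1) - a * \<phi> (x 0) - a * \<phi> (x 1) + a * a)"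
    by (simp add: algebra_simps)
  also have "\<dots> = expectation (\<lambda>x. \<phi> (x 0) * \<phi> (x 1)) - a * a - a * expectation (\<lambda>x. \<phi> (x 1)) + a * a"
    using i1 i2 by (simp add: prob_space a_def)
  also have "expectation (\<lambda>x. \<phi> (x 1)) = a"
    unfolding a_def by (rule expectation_coordinate) measurable
  finally show ?thesis by (simp add: power2_eq_square)
qed

text \<open>Here the infinite length of the sequence enters: an exchangeable pair alone may be
  negatively correlated, but arbitrarily many equicorrelated variables may not.\<close>

lemma covariance_nonneg:
  fixes \<phi> :: "real^'d \<Rightarrow> real"
  assumes \<phi> [measurable]: "\<phi> \<in> borel_measurable borel" and bdd: "\<And>x. \<bar>\<phi> x\<bar> \<le> B"
  shows "(expectation (\<lambda>x. \<phi> (x 0)))\<^sup>2 \<le> expectation (\<lambda>x. \<phi> (x 0) * \<phi> (x 1))"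
proof -
  define a where "a = expectation (\<lambda>x. \<phi> (x 0))"
  have "0 \<le> expectation (\<lambda>x. (\<phi> (x 0) - a) * (\<phi> (x 1) - a))"
  proof (rule equicorrelated_cov_nonneg[where Y="\<lambda>i x. \<phi> (x i) - a"])
    show "\<bar>\<phi> (x i) - a\<bar> \<le> B + \<bar>a\<bar>" for i and x :: "nat \<Rightarrow> real^'d"
      using bdd[of "x i"] by linarith
    show "expectation (\<lambda>x. (\<phi> (x i) - a) * (\<phi> (x i) - a)) = expectation (\<lambda>x. (\<phi> (x 0) - a) * (\<phi> (x 0) - a))" for i
      by (rule expectation_coordinate) measurable
    show "expectation (\<lambda>x. (\<phi> (x i) - a) * (\<phi> (x j) - a)) = expectation (\<lambda>x. (\<phi> (x 0) - a) * (\<phi> (x 1) - a))"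
      if "i \<noteq> j" for i j
      by (rule expectation_two_coordinates) (use that in measurable)
  qed measurable
  then show ?thesis
    using covariance_centered[OF \<phi> bdd] by (simp add: a_def)
qed

text \<open>The decoupling step of the uniqueness proof. The centred variables
  \<open>\<phi> (x (n + i)) - a\<close> are pairwise uncorrelated and all have the same correlation
  with the cylinder indicator, so \<open>uncorrelated_orthogonal\<close> makes this correlation
  zero.\<close>

lemma expectation_cylinder_factor:
  fixes \<phi> :: "real^'d \<Rightarrow> real"
  assumes \<phi> [measurable]: "\<phi> \<in> borel_measurable borel" and bdd: "\<And>x. \<bar>\<phi> x\<bar> \<le> B"
    and cov: "expectation (\<lambda>x. \<phi> (x 0) * \<phi> (x 1)) = (expectation (\<lambda>x. \<phi> (x 0)))\<^sup>2"
    and A [measurable]: "\<And>i. A i \<in> sets borel"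
  shows "expectation (\<lambda>x. (\<Prod>i<n. indicator (A i) (x i)) * \<phi> (x n))
    = expectation (\<lambda>x. \<Prod>i<n. indicator (A i) (x i)) * expectation (\<lambda>x. \<phi> (x 0))"
proof -
  define a where "a = expectation (\<lambda>x. \<phi> (x 0))"
  define X :: "(nat \<Rightarrow> real^'d) \<Rightarrow> real" where "X x = (\<Prod>i<n. indicator (A i) (x i))" for x
  have [measurable]: "X \<in> borel_measurable \<gamma>" unfolding X_def by measurable
  have X01: "\<bar>X x\<bar> \<le> 1" for x
    unfolding X_def abs_prod by (intro prod_le_1) (auto simp: indicator_def)
  have iX: "integrable \<gamma> X" by (rule integrable_const_bound[of _ 1]) (use X01 in auto)
  have iX\<phi>: "integrable \<gamma> (\<lambda>x. X x * \<phi> (x m))" for m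
  proof (rule integrable_const_bound[of _ "1 * B"])
    show "AE x in \<gamma>. norm (X x * \<phi> (x m)) \<le> 1 * B"
      unfolding real_norm_def abs_mult using bdd X01 by (intro AE_I2 mult_mono) auto
  qed measurable
  have XY: "expectation (\<lambda>x. X x * (\<phi> (x m) - a)) = expectation (\<lambda>x. X x * \<phi> (x m)) - a * expectation X" for m
  proof -
    have "expectation (\<lambda>x. X x * (\<phi> (x m) - a)) = expectation (\<lambda>x. X x * \<phi> (x m) - a * X x)"
      by (simp add: algebra_simps)
    then show ?thesis using iX iX\<phi> by simp
  qed
  have "expectation (\<lambda>x. X x * (\<phi> (x n) - a)) = 0"
  \<comment> \<open>The shift by \<open>n\<close> keeps the family off the coordinates that
    \<open>X\<close> depends on.\<close>
  proof (rule uncorrelated_orthogonal[where Y="\<lambda>i x. \<phi> (x (n + i)) - a" and X=X])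
    show "\<bar>\<phi> (x (n + i)) - a\<bar> \<le> B + \<bar>a\<bar>" for i and x :: "nat \<Rightarrow> real^'d"
      using bdd[of "x (n + i)"] by linarith
    show "expectation (\<lambda>x. (\<phi> (x (n + i)) - a) * (\<phi> (x (n + i)) - a)) = expectation (\<lambda>x. (\<phi> (x 0) - a) * (\<phi> (x 0) - a))" for i
      by (rule expectation_coordinate) measurable
    show "expectation (\<lambda>x. (\<phi> (x (n + i)) - a) * (\<phi> (x (n + j)) - a)) = 0" if "i \<noteq> j" for i j
    proof -
      have "expectation (\<lambda>x. (\<phi> (x (n + i)) - a) * (\<phi> (x (n + j)) - a)) = expectation (\<lambda>x. (\<phi> (x 0) - a) * (\<phi> (x 1) - a))"
        by (rule expectation_two_coordinates) (use that in \<open>auto\<close>)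
      then show ?thesis using covariance_centered[OF \<phi> bdd] cov by (simp add: a_def)
    qed
    show "expectation (\<lambda>x. X x * (\<phi> (x (n + i)) - a)) = expectation (\<lambda>x. X x * (\<phi> (x n) - a))" for i
      unfolding XY using expectation_cylinder_coordinate[OF \<phi> A, of n "n + i"] by (simp add: X_def)
  qed (use X01 in \<open>auto\<close>)
  then show ?thesis unfolding XY by (simp add: X_def[abs_def] a_def mult.commute)
qed

end

lemma integral_pair_prod:
  fixes f g :: "'a \<Rightarrow> real"
  assumes "prob_space M" and [measurable]: "f \<in> borel_measurable M" "g \<in> borel_measurable M"
    and bdd: "\<And>x. \<bar>f x\<bar> \<le> 1" "\<And>x. \<bar>g x\<bar> \<le> 1"
  shows "(\<integral>p. f (fst p) * g (snd p) \<partial>(M \<Otimes>\<^sub>M M)) = integral\<^sup>L M f * integral\<^sup>L M g"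
    and "integrable (M \<Otimes>\<^sub>M M) (\<lambda>p. f (fst p) * g (snd p))"
proof -
  interpret M: prob_space M by fact
  interpret pair_prob_space M M ..
  show int: "integrable (M \<Otimes>\<^sub>M M) (\<lambda>p. f (fst p) * g (snd p))"
    by (rule P.integrable_const_bound[of _ 1])
       (use bdd in \<open>auto simp: abs_mult intro!: AE_I2 mult_le_one\<close>)
  then have "(\<integral>p. f (fst p) * g (snd p) \<partial>(M \<Otimes>\<^sub>M M)) = (\<integral>x. \<integral>y. f x * g y \<partial>M \<partial>M)"
    using integral_fst'[OF int] by simp
  then show "(\<integral>p. f (fst p) * g (snd p) \<partial>(M \<Otimes>\<^sub>M M)) = integral\<^sup>L M f * integral\<^sup>L M g"
    by simp
qed

section \<open>Laws of differences and independence of the coordinates\<close>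

context exchangeable
begin

definition one_body :: "(real^'d) measure" where
  "one_body = distr \<gamma> borel (\<lambda>x. x 0)"

text \<open>A cost of the form \<open>l (x - y)\<close> sees a pair only through its difference, so
  the problem reduces to comparing this law with \<open>diff_law_indep\<close>.\<close>

definition diff_law :: "(real^'d) measure" where
  "diff_law = distr \<gamma> borel (\<lambda>x. x 0 - x 1)"

definition diff_law_indep :: "(real^'d) measure" where
  "diff_law_indep = distr (one_body \<Otimes>\<^sub>M one_body) borel (\<lambda>p. fst p - snd p)"

lemma sets_one_body [simp, measurable_cong]: "sets one_body = sets borel"
  by (simp add: one_body_def)

lemma space_one_body [simp]: "space one_body = UNIV"
  by (simp add: one_body_def)

lemma prob_space_one_body: "prob_space one_body"
  unfolding one_body_def by (rule prob_space_distr) measurable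

lemma integral_one_body:
  fixes \<phi> :: "real^'d \<Rightarrow> real"
  assumes "\<phi> \<in> borel_measurable borel"
  shows "integral\<^sup>L one_body \<phi> = expectation (\<lambda>x. \<phi> (x 0))"
  unfolding one_body_def using assms by (subst integral_distr) auto

lemma integral_cos_diff_law:
  "(\<integral>z. cos (k \<bullet> z) \<partial>diff_law)
    = expectation (\<lambda>x. cos (k \<bullet> x 0) * cos (k \<bullet> x 1)) + expectation (\<lambda>x. sin (k \<bullet> x 0) * sin (k \<bullet> x 1))"
proof -
  have "integrable \<gamma> (\<lambda>x. cos (k \<bullet> x 0) * cos (k \<bullet> x 1))" "integrable \<gamma> (\<lambda>x. sin (k \<bullet> x 0) * sin (k \<bullet> x 1))"
    by (rule integrable_const_bound[of _ 1]; auto simp: abs_mult intro!: AE_I2 mult_le_one)+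
  then show ?thesis
    unfolding diff_law_def by (subst integral_distr) (auto simp: inner_diff_right cos_diff)
qed

text \<open>The right-hand side is the squared modulus of the characteristic function of
  \<open>one_body\<close>.\<close>

lemma integral_cos_diff_law_indep:
  "(\<integral>z. cos (k \<bullet> z) \<partial>diff_law_indep)
    = (expectation (\<lambda>x. cos (k \<bullet> x 0)))\<^sup>2 + (expectation (\<lambda>x. sin (k \<bullet> x 0)))\<^sup>2"
proof -
  note c = integral_pair_prod[OF prob_space_one_body, of "\<lambda>x. cos (k \<bullet> x)" "\<lambda>x. cos (k \<bullet> x)"]
  note s = integral_pair_prod[OF prob_space_one_body, of "\<lambda>x. sin (k \<bullet> x)" "\<lambda>x. sin (k \<bullet> x)"]
  show ?thesis
    unfolding diff_law_indep_def using c s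
    by (subst integral_distr)
       (auto simp: inner_diff_right cos_diff integral_one_body power2_eq_square)
qed

lemma spectral_dominance_diff_law: "spectral_dominance diff_law diff_law_indep"
proof -
  interpret m: prob_space one_body by (rule prob_space_one_body)
  interpret mm: pair_prob_space one_body one_body ..
  interpret P: prob_space diff_law unfolding diff_law_def by (rule prob_space_distr) measurable
  interpret Q: prob_space diff_law_indep unfolding diff_law_indep_def by (rule mm.prob_space_distr) measurable
  show ?thesis
  proof
    show "(\<integral>z. cos (k \<bullet> z) \<partial>diff_law_indep) \<le> (\<integral>z. cos (k \<bullet> z) \<partial>diff_law)" for k
      unfolding integral_cos_diff_law integral_cos_diff_law_indep
      by (intro add_mono covariance_nonneg[of _ 1]) auto
  qed (simp_all add: diff_law_def diff_law_indep_def)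
qed

sublocale spectral_dominance diff_law diff_law_indep
  by (rule spectral_dominance_diff_law)

text \<open>\<open>gap k\<close> is the sum of the covariances of the cosine and of the sine; both
  are nonnegative, so neither survives when the sum is zero.\<close>

lemma trig_covariance_zero:
  assumes "gap k = 0"
  shows "expectation (\<lambda>x. cos (k \<bullet> x 0) * cos (k \<bullet> x 1)) = (expectation (\<lambda>x. cos (k \<bullet> x 0)))\<^sup>2"
    and "expectation (\<lambda>x. sin (k \<bullet> x 0) * sin (k \<bullet> x 1)) = (expectation (\<lambda>x. sin (k \<bullet> x 0)))\<^sup>2"
  using assms covariance_nonneg[of "\<lambda>x. cos (k \<bullet> x)" 1] covariance_nonneg[of "\<lambda>x. sin (k \<bullet> x)" 1]
  by (auto simp: gap_def integral_cos_diff_law integral_cos_diff_law_indep)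

text \<open>For almost every \<open>k\<close> the cosine and sine of \<open>k \<bullet> x 1\<close>
  decouple from any event on \<open>x 0\<close>. These transforms determine the law of
  \<open>x 1\<close> on that event.\<close>

lemma two_coordinates_independent:
  assumes gap: "AE k in lborel. gap k = 0" and [measurable]: "A \<in> sets borel" "C \<in> sets borel"
  shows "expectation (\<lambda>x. indicator C (x 0) * indicator A (x 1)) = measure one_body C * measure one_body A"
proof -
  interpret m: prob_space one_body by (rule prob_space_one_body)
  \<comment> \<open>The law of \<open>x 1\<close> on the event that \<open>x 0\<close> lies in
    \<open>C\<close>, left unnormalised so that an event of probability zero needs no separate
    treatment.\<close>
  define M where "M = distr (density \<gamma> (\<lambda>x. ennreal (indicator C (x 0)))) borel (\<lambda>x. x 1)"
  define N where "N = density one_body (\<lambda>_. ennreal (measure one_body C))"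
  have intM: "integral\<^sup>L M \<phi> = expectation (\<lambda>x. indicator C (x 0) * \<phi> (x 1))"
    if [measurable]: "\<phi> \<in> borel_measurable borel" for \<phi> :: "real^'d \<Rightarrow> real"
    unfolding M_def by (subst integral_distr, measurable, subst integral_density) auto
  have intN: "integral\<^sup>L N \<phi> = measure one_body C * expectation (\<lambda>x. \<phi> (x 0))"
    if [measurable]: "\<phi> \<in> borel_measurable borel" for \<phi> :: "real^'d \<Rightarrow> real"
    unfolding N_def by (subst integral_density) (auto simp: integral_one_body)
  have finM: "finite_measure M"
  proof
    have "emeasure M (space M) = (\<integral>\<^sup>+ x. ennreal (indicator C (x 0)) \<partial>\<gamma>)"
      unfolding M_def by (simp add: emeasure_distr emeasure_density)
    also have "\<dots> \<le> (\<integral>\<^sup>+ x. 1 \<partial>\<gamma>)"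
      by (intro nn_integral_mono) (auto simp: indicator_def)
    finally show "emeasure M (space M) \<noteq> \<infinity>" by (auto simp: emeasure_space_1 top_unique)
  qed
  have finN: "finite_measure N"
    by (rule finite_measureI) (simp add: N_def emeasure_density m.emeasure_space_1[simplified])
  have C1: "expectation (\<lambda>x. indicator C (x 0)) = measure one_body C"
    using integral_one_body[of "indicator C"] by simp
  have factor: "expectation (\<lambda>x. indicator C (x 0) * \<phi> (x 1)) = measure one_body C * expectation (\<lambda>x. \<phi> (x 0))"
    if "\<phi> \<in> borel_measurable borel" "\<And>x. \<bar>\<phi> x\<bar> \<le> 1"
      "expectation (\<lambda>x. \<phi> (x 0) * \<phi> (x 1)) = (expectation (\<lambda>x. \<phi> (x 0)))\<^sup>2" for \<phi> :: "real^'d \<Rightarrow> real"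
    \<comment> \<open>With \<open>n = 1\<close> the cylinder is the event \<open>C\<close> on
      coordinate 0.\<close>
    using expectation_cylinder_factor[OF that, of "\<lambda>_. C" 1] by (simp add: C1)
  have MN: "M = N"
  proof (rule finite_measure_eqI_trig[OF finM finN])
    show "AE k in lborel. (\<integral>x. cos (k \<bullet> x) \<partial>M) = (\<integral>x. cos (k \<bullet> x) \<partial>N)"
      using gap
    proof eventually_elim
      case (elim k)
      then show ?case
        using factor[of "\<lambda>x. cos (k \<bullet> x)"] trig_covariance_zero[OF elim] by (simp add: intM intN)
    qed
    show "AE k in lborel. (\<integral>x. sin (k \<bullet> x) \<partial>M) = (\<integral>x. sin (k \<bullet> x) \<partial>N)"
      using gap
    proof eventually_elim
      case (elim k)
      then show ?case
        using factor[of "\<lambda>x. sin (k \<bullet> x)"] trig_covariance_zero[OF elim] by (simp add: intM intN)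
    qed
  qed (simp_all add: M_def N_def)
  have "expectation (\<lambda>x. indicator C (x 0) * indicator A (x 1)) = integral\<^sup>L M (indicat_real A)"
    by (rule intM[symmetric]) measurable
  also have "\<dots> = measure one_body C * expectation (\<lambda>x. indicat_real A (x 0))"
    unfolding MN by (rule intN) measurable
  also have "expectation (\<lambda>x. indicat_real A (x 0)) = measure one_body A"
    using integral_one_body[of "indicator A"] by simp
  finally show ?thesis .
qed

text \<open>Independence of two coordinates gives the indicator of \<open>A n\<close> zero
  covariance between sites, so \<open>expectation_cylinder_factor\<close> applies to it and peels
  off the last coordinate.\<close>

lemma cylinder_expectation_eq_prod:
  assumes gap: "AE k in lborel. gap k = 0" and A [measurable]: "\<And>i. A i \<in> sets borel"
  shows "expectation (\<lambda>x. \<Prod>i<n. indicator (A i) (x i)) = (\<Prod>i<n. measure one_body (A i))"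
proof (induction n)
  case 0
  show ?case by (simp add: prob_space)
next
  case (Suc n)
  have A1: "expectation (\<lambda>x. indicator (A n) (x 0)) = measure one_body (A n)"
    using integral_one_body[of "indicator (A n)"] by simp
  have "expectation (\<lambda>x. (\<Prod>i<n. indicator (A i) (x i)) * indicat_real (A n) (x n))
      = expectation (\<lambda>x. \<Prod>i<n. indicat_real (A i) (x i)) * expectation (\<lambda>x. indicat_real (A n) (x 0))"
  proof (rule expectation_cylinder_factor[where B=1])
    show "expectation (\<lambda>x. indicat_real (A n) (x 0) * indicat_real (A n) (x 1)) = (expectation (\<lambda>x. indicat_real (A n) (x 0)))\<^sup>2"
      using two_coordinates_independent[OF gap A[of n] A[of n]] by (simp add: A1 power2_eq_square)
  qed (auto simp: indicator_def)
  then show ?case by (simp add: Suc A1)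
qed

lemma eq_product_if_gap_zero:
  assumes gap: "AE k in lborel. gap k = 0"
  shows "\<gamma> = PiM UNIV (\<lambda>_. one_body)"
proof -
  interpret m: prob_space one_body by (rule prob_space_one_body)
  interpret pp: product_prob_space "\<lambda>_::nat. one_body" UNIV ..
  show ?thesis
  proof (rule pp.PiM_eq)
    show "sets \<gamma> = sets (PiM UNIV (\<lambda>_. one_body))"
      by (simp add: sets_seq cong: sets_PiM_cong)
    fix J :: "nat set" and F :: "nat \<Rightarrow> (real^'d) set"
    assume J: "finite J" and F: "\<And>j. j \<in> J \<Longrightarrow> F j \<in> sets one_body"
    obtain n where n: "\<And>j. j \<in> J \<Longrightarrow> j < n" using J by (auto simp: finite_nat_set_iff_bounded)
    \<comment> \<open>Padding with \<open>UNIV\<close> turns a cylinder over \<open>J\<close> into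
      one over an initial segment; the added factors have measure 1.\<close>
    define A where "A i = (if i \<in> J then F i else UNIV)" for i
    have A [measurable]: "A i \<in> sets borel" for i using F by (simp add: A_def)
    define S where "S = prod_emb UNIV (\<lambda>_. one_body) J (\<Pi>\<^sub>E j\<in>J. F j)"
    have "S = {x. \<forall>j\<in>J. x j \<in> F j}"
      by (auto simp: S_def prod_emb_def PiE_iff)
    also have "\<dots> = {x. \<forall>i<n. x i \<in> A i}"
      using n by (auto simp: A_def)
    finally have S: "S = {x. \<forall>i<n. x i \<in> A i}" .
    have "S \<in> sets (PiM UNIV (\<lambda>_. one_body))"
      unfolding S_def using J F by (intro sets_PiM_I) auto
    then have "S \<in> sets \<gamma>" by (simp add: sets_seq cong: sets_PiM_cong)
    have "(\<Prod>i<n. indicator (A i) (x i)) = (indicator S x :: real)" for x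
      by (auto simp: S indicator_def prod_zero_iff)
    then have "prob S = (\<Prod>i<n. measure one_body (A i))"
      using cylinder_expectation_eq_prod[where A=A and n=n, OF gap A] \<open>S \<in> sets \<gamma>\<close> sets.sets_into_space[of S \<gamma>]
      by (simp add: Int_absorb2)
    also have "\<dots> = (\<Prod>j\<in>J. measure one_body (F j))"
    proof (rule prod.mono_neutral_cong_right)
      show "\<forall>i\<in>{..<n} - J. measure one_body (A i) = 1"
        using m.prob_space by (simp add: A_def)
    qed (use n in \<open>auto simp: A_def\<close>)
    finally show "emeasure \<gamma> S = (\<Prod>j\<in>J. emeasure one_body (F j))"
      by (simp add: emeasure_eq_measure m.emeasure_eq_measure prod_ennreal)
  qed
qed

end

section \<open>The infinite-body problem\<close>

text \<open>Through this the vanishing imaginary part in the cost hypotheses becomes the vanishing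
  sine transform that \<open>mollified_gap\<close> asks for.\<close>

lemma fourier_real_parts:
  fixes f :: "real^'d \<Rightarrow> real"
  assumes f: "integrable lborel f"
  shows "Re (fourier f k) = (\<integral>u. f u * cos (k \<bullet> u) \<partial>lborel)"
    and "Im (fourier f k) = - (\<integral>u. f u * sin (k \<bullet> u) \<partial>lborel)"
proof -
  have [measurable]: "f \<in> borel_measurable borel"
    using borel_measurable_integrable[OF f] by simp
  have int: "integrable lborel (\<lambda>x. cis (- (k \<bullet> x)) * complex_of_real (f x))"
    by (rule Bochner_Integration.integrable_bound[OF f]) (auto simp: norm_mult)
  show "Re (fourier f k) = (\<integral>u. f u * cos (k \<bullet> u) \<partial>lborel)"
    unfolding fourier_def integral_Re[OF int, symmetric] by (simp add: mult.commute)
  show "Im (fourier f k) = - (\<integral>u. f u * sin (k \<bullet> u) \<partial>lborel)"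
    unfolding fourier_def integral_Im[OF int, symmetric] by (simp add: mult.commute)
qed

lemma (in prob_space) nn_integral_bounded_eq:
  fixes f :: "'a \<Rightarrow> real"
  assumes "f \<in> borel_measurable M" "\<And>x. 0 \<le> f x" "\<And>x. \<bar>f x\<bar> \<le> B"
  shows "(\<integral>\<^sup>+ x. ennreal (f x) \<partial>M) = ennreal (integral\<^sup>L M f)"
  by (rule nn_integral_eq_integral, rule integrable_const_bound[of _ B]) (use assms in auto)

lemma spectral_dominance_cost_le:
  fixes l :: "real^'d \<Rightarrow> ennreal"
  assumes "spectral_dominance P Q" and l: "case_i l \<or> case_ii l"
  shows "(\<integral>\<^sup>+ z. l z \<partial>Q) \<le> (\<integral>\<^sup>+ z. l z \<partial>P)"
proof -
  interpret spectral_dominance P Q by fact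
  show ?thesis
    using l
  proof
    assume "case_i l"
    then obtain f where f: "\<And>z. f z \<ge> 0" "l = (\<lambda>z. ennreal (f z))" "integrable lborel f"
        "continuous_on UNIV f" "bounded (range f)" "\<And>k. Im (fourier f k) = 0" "\<And>k. Re (fourier f k) \<ge> 0"
      unfolding case_i_def by auto
    from f(5) obtain B where B: "\<And>x. \<bar>f x\<bar> \<le> B" by (auto simp: bounded_iff)
    have sin: "(\<integral>u. f u * sin (k \<bullet> u) \<partial>lborel) = 0" for k
      using f(6)[of k] fourier_real_parts(2)[OF f(3), of k] by simp
    have [measurable]: "f \<in> borel_measurable borel"
      using f(4) by (rule borel_measurable_continuous_onI)
    have "integral\<^sup>L Q f \<le> integral\<^sup>L P f"
      by (rule positive_type_le[OF f(3,4) B fourier_real_parts(1)[OF f(3), symmetric] sin f(7)])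
    then show ?thesis
      using P.nn_integral_bounded_eq[OF _ f(1) B] Q.nn_integral_bounded_eq[OF _ f(1) B]
      by (simp add: f(2) ennreal_leI)
  next
    assume "case_ii l"
    then have "l = (\<lambda>z. if z = 0 then \<infinity> else ennreal (1 / norm z))" by (simp add: case_ii_def)
    then show ?thesis using coulomb_le by (simp only:)
  qed
qed

lemma spectral_dominance_cost_eqD:
  fixes l :: "real^'d \<Rightarrow> ennreal"
  assumes "spectral_dominance P Q" and l: "case_i_strict l \<or> case_ii l"
    and eq: "(\<integral>\<^sup>+ z. l z \<partial>P) = (\<integral>\<^sup>+ z. l z \<partial>Q)" and fin: "(\<integral>\<^sup>+ z. l z \<partial>Q) < \<infinity>"
  shows "AE k in lborel. spectral_dominance.gap P Q k = 0"
proof -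
  interpret spectral_dominance P Q by fact
  show ?thesis
    using l
  proof
    assume "case_i_strict l"
    then obtain f where f: "\<And>z. f z \<ge> 0" "l = (\<lambda>z. ennreal (f z))" "integrable lborel f"
        "continuous_on UNIV f" "bounded (range f)" "\<And>k. Im (fourier f k) = 0" "\<And>k. Re (fourier f k) > 0"
      unfolding case_i_strict_def by auto
    from f(5) obtain B where B: "\<And>x. \<bar>f x\<bar> \<le> B" by (auto simp: bounded_iff)
    have sin: "(\<integral>u. f u * sin (k \<bullet> u) \<partial>lborel) = 0" for k
      using f(6)[of k] fourier_real_parts(2)[OF f(3), of k] by simp
    have [measurable]: "f \<in> borel_measurable borel"
      using f(4) by (rule borel_measurable_continuous_onI)
    have "integral\<^sup>L P f = integral\<^sup>L Q f"
      using eq P.nn_integral_bounded_eq[OF _ f(1) B] Q.nn_integral_bounded_eq[OF _ f(1) B] f(1)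
      by (simp add: f(2) integral_nonneg)
    then show ?thesis
      by (rule positive_type_eqD[OF f(3,4) B fourier_real_parts(1)[OF f(3), symmetric] sin f(7)])
  next
    assume "case_ii l"
    then have "l = (\<lambda>z. if z = 0 then \<infinity> else ennreal (1 / norm z))" by (simp add: case_ii_def)
    then show ?thesis using coulomb_eqD eq fin by (simp only:)
  qed
qed

section \<open>The product measure as a competitor, and the theorem\<close>

lemma distr_PiM_two_coordinates:
  fixes \<mu> :: "'a measure"
  assumes "prob_space \<mu>"
  shows "distr (PiM UNIV (\<lambda>_::nat. \<mu>)) (\<mu> \<Otimes>\<^sub>M \<mu>) (\<lambda>x. (x 0, x 1)) = \<mu> \<Otimes>\<^sub>M \<mu>"
proof (rule pair_measure_eqI[symmetric])
  interpret m: prob_space \<mu> by fact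
  interpret pp: product_prob_space "\<lambda>_::nat. \<mu>" UNIV ..
  show "sigma_finite_measure \<mu>" "sigma_finite_measure \<mu>" by unfold_locales
  fix A B assume [measurable]: "A \<in> sets \<mu>" "B \<in> sets \<mu>"
  have "(\<lambda>x. (x 0, x 1)) -` (A \<times> B) \<inter> space (PiM UNIV (\<lambda>_::nat. \<mu>))
      = {x \<in> space (PiM UNIV (\<lambda>_::nat. \<mu>)). \<forall>i\<in>{0, 1}. x i \<in> (if i = 0 then A else B)}"
    by auto
  then show "emeasure \<mu> A * emeasure \<mu> B = emeasure (distr (PiM UNIV (\<lambda>_::nat. \<mu>)) (\<mu> \<Otimes>\<^sub>M \<mu>) (\<lambda>x. (x 0, x 1))) (A \<times> B)"
    using pp.emeasure_PiM_Collect[of "{0, 1}" "\<lambda>i. if i = 0 then A else B"]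
    by (simp add: emeasure_distr)
qed simp

lemma admissible_PiM:
  fixes \<mu> :: "(real^'d) measure"
  assumes mu: "prob_space \<mu>" and sets: "sets \<mu> = sets borel"
  shows "admissible \<mu> (PiM UNIV (\<lambda>_. \<mu>))"
  unfolding admissible_def symmetric_meas_def
proof (intro conjI allI impI)
  note [measurable_cong] = sets
  have sets_I: "sets (PiM I (\<lambda>_. \<mu>)) = sets (PiM I (\<lambda>_. borel))" for I :: "nat set"
    using sets by (intro sets_PiM_cong) auto
  show "prob_space (PiM UNIV (\<lambda>_::nat. \<mu>))" by (rule prob_space_PiM) (rule mu)
  show "sets (PiM UNIV (\<lambda>_::nat. \<mu>)) = sets seq_space" by (rule sets_I)
  have "distr (PiM UNIV (\<lambda>_::nat. \<mu>)) borel (\<lambda>x. x 0) = distr (PiM UNIV (\<lambda>_::nat. \<mu>)) \<mu> (\<lambda>x. x 0)"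
    by (rule distr_cong) (simp_all add: sets)
  also have "\<dots> = \<mu>"
    by (rule distr_PiM_component) (simp_all add: mu)
  finally show "distr (PiM UNIV (\<lambda>_::nat. \<mu>)) borel (\<lambda>x. x 0) = \<mu>" .
  \<comment> \<open>Both sides of the symmetry condition are reindexings of the product measure by
    an injective map, namely \<open>\<sigma>\<close> and the identity, and both give the product
    over \<open>I\<close>.\<close>
  have reindex: "distr (PiM UNIV (\<lambda>_::nat. \<mu>)) (PiM I (\<lambda>_. borel)) (\<lambda>x. \<lambda>i\<in>I. x (\<sigma> i)) = PiM I (\<lambda>_. \<mu>)"
    if "inj_on \<sigma> I" for I and \<sigma> :: "nat \<Rightarrow> nat"
  proof -
    have "distr (PiM UNIV (\<lambda>_::nat. \<mu>)) (PiM I (\<lambda>_. borel)) (\<lambda>x. \<lambda>i\<in>I. x (\<sigma> i))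
        = distr (PiM UNIV (\<lambda>_::nat. \<mu>)) (PiM I (\<lambda>_. \<mu>)) (\<lambda>x. \<lambda>i\<in>I. x (\<sigma> i))"
      by (rule distr_cong) (simp_all add: sets_I)
    also have "\<dots> = PiM I (\<lambda>_. \<mu>)"
      by (rule distr_PiM_reindex) (simp_all add: mu that)
    finally show ?thesis .
  qed
  fix I :: "nat set" and \<sigma> assume "finite I \<and> \<sigma> permutes I"
  then have "inj_on \<sigma> I" by (auto intro: permutes_inj_on)
  then show "distr (PiM UNIV (\<lambda>_::nat. \<mu>)) (PiM I (\<lambda>_. borel)) (\<lambda>x. restrict (x \<circ> \<sigma>) I)
      = distr (PiM UNIV (\<lambda>_::nat. \<mu>)) (PiM I (\<lambda>_. borel)) (\<lambda>x. restrict x I)"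
    using reindex[of \<sigma> I] reindex[of "\<lambda>i. i" I] by (simp add: comp_def)
qed

theorem theorem1p1:
  fixes l :: "real^'d \<Rightarrow> ennreal" and \<mu> :: "(real^'d) measure"
  defines "c \<equiv> (\<lambda>x y. l (x - y))"
  assumes l_sym: "\<And>z. l z = l (- z)"
    and l_meas: "l \<in> borel_measurable borel"
    and l_cases: "case_i l \<or> case_ii l"
    and mu_prob: "prob_space \<mu>" and mu_sets: "sets \<mu> = sets borel"
    and mu_finite: "(\<integral>\<^sup>+ x. \<integral>\<^sup>+ y. c x y \<partial>\<mu> \<partial>\<mu>) < \<infinity>"
  shows "admissible \<mu> (PiM UNIV (\<lambda>_. \<mu>))
       \<and> C_inf c (PiM UNIV (\<lambda>_. \<mu>)) = F_OT_inf c \<mu>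
       \<and> F_OT_inf c \<mu> = (\<integral>\<^sup>+ x. \<integral>\<^sup>+ y. c x y \<partial>\<mu> \<partial>\<mu>)
       \<and> ((case_i_strict l \<or> case_ii l) \<longrightarrow>
            (\<forall>\<gamma>. admissible \<mu> \<gamma> \<and> C_inf c \<gamma> = F_OT_inf c \<mu> \<longrightarrow> \<gamma> = PiM UNIV (\<lambda>_. \<mu>)))"
proof -
  note [measurable] = l_meas and [measurable_cong] = mu_sets
  interpret m: prob_space \<mu> by fact
  define E where "E = (\<integral>\<^sup>+ x. \<integral>\<^sup>+ y. c x y \<partial>\<mu> \<partial>\<mu>)"
  have E_pair: "E = (\<integral>\<^sup>+ p. l (fst p - snd p) \<partial>(\<mu> \<Otimes>\<^sub>M \<mu>))"
    unfolding E_def c_def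
    using m.nn_integral_fst[of "\<lambda>p. l (fst p - snd p)" \<mu>] by simp
  have adm: "admissible \<mu> (PiM UNIV (\<lambda>_. \<mu>))"
    by (rule admissible_PiM[OF mu_prob mu_sets])
  have C_PiM: "C_inf c (PiM UNIV (\<lambda>_. \<mu>)) = E"
    unfolding E_pair C_inf_def c_def
    by (subst distr_PiM_two_coordinates[OF mu_prob, symmetric], subst nn_integral_distr) auto
  \<comment> \<open>Each admissible measure has its own difference laws; since its one-body marginal
    is \<open>\<mu>\<close>, the independent one always has cost \<open>E\<close>.\<close>
  have exch: "exchangeable \<gamma>" and one: "exchangeable.one_body \<gamma> = \<mu>"
    and C: "C_inf c \<gamma> = (\<integral>\<^sup>+ z. l z \<partial>exchangeable.diff_law \<gamma>)"
    and EQ: "E = (\<integral>\<^sup>+ z. l z \<partial>exchangeable.diff_law_indep \<gamma>)"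
    if "admissible \<mu> \<gamma>" for \<gamma>
  proof -
    show ex: "exchangeable \<gamma>"
      using that unfolding admissible_def exchangeable_def exchangeable_axioms_def by blast
    interpret exchangeable \<gamma> by fact
    show one: "one_body = \<mu>" using that unfolding admissible_def one_body_def by blast
    show "C_inf c \<gamma> = (\<integral>\<^sup>+ z. l z \<partial>diff_law)"
      unfolding C_inf_def c_def diff_law_def by (subst nn_integral_distr) auto
    show "E = (\<integral>\<^sup>+ z. l z \<partial>diff_law_indep)"
      unfolding E_pair diff_law_indep_def one by (subst nn_integral_distr) auto
  qed
  have lower: "E \<le> C_inf c \<gamma>" if "admissible \<mu> \<gamma>" for \<gamma>
    unfolding C[OF that] EQ[OF that]
    by (rule spectral_dominance_cost_le[OF exchangeable.spectral_dominance_diff_law[OF exch[OF that]] l_cases])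
  have F: "F_OT_inf c \<mu> = E"
    unfolding F_OT_inf_def
  proof (rule antisym)
    show "(INF \<gamma>\<in>{\<gamma>. admissible \<mu> \<gamma>}. C_inf c \<gamma>) \<le> E"
      using adm C_PiM by (intro INF_lower2[of "PiM UNIV (\<lambda>_. \<mu>)"]) auto
    show "E \<le> (INF \<gamma>\<in>{\<gamma>. admissible \<mu> \<gamma>}. C_inf c \<gamma>)"
      using lower by (intro INF_greatest) auto
  qed
  have unique: "\<gamma> = PiM UNIV (\<lambda>_. \<mu>)"
    if strict: "case_i_strict l \<or> case_ii l" and \<gamma>: "admissible \<mu> \<gamma>" and min: "C_inf c \<gamma> = F_OT_inf c \<mu>" for \<gamma>
  proof -
    interpret exchangeable \<gamma> by (rule exch[OF \<gamma>])
    have "AE k in lborel. gap k = 0"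
      using strict
    proof (rule spectral_dominance_cost_eqD[OF spectral_dominance_diff_law])
      show "(\<integral>\<^sup>+ z. l z \<partial>diff_law) = (\<integral>\<^sup>+ z. l z \<partial>diff_law_indep)"
        using min F C[OF \<gamma>] EQ[OF \<gamma>] by simp
      show "(\<integral>\<^sup>+ z. l z \<partial>diff_law_indep) < \<infinity>"
        using mu_finite EQ[OF \<gamma>] by (simp add: E_def)
    qed
    then show ?thesis using eq_product_if_gap_zero one[OF \<gamma>] by simp
  qed
  show ?thesis
  proof (intro conjI impI allI)
    show "C_inf c (PiM UNIV (\<lambda>_. \<mu>)) = F_OT_inf c \<mu>" using C_PiM F by simp
    show "F_OT_inf c \<mu> = (\<integral>\<^sup>+ x. \<integral>\<^sup>+ y. c x y \<partial>\<mu> \<partial>\<mu>)" using F by (simp only: E_def)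
  qed (use adm unique in blast)+
qed

end
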